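(* Fix a root $e$ of $x^2+6x+3$ in $\mathbb{F}_{7^2}$. Every non-exceptional permutation polynomial of degree $7$ over $\mathbb{F}_{7^2}$ is linearly related to $$x^7+ex^5+e^{18}x^3+e^{35}x.$$ Every exceptional polynomial of degree $7$ over $\mathbb{F}_{7^2}$ is linearly related to exactly one of the following polynomials: (i) $x^7+ax$ with $a\in\{0,e,e^2,e^3,e^4,e^5\}$; (ii) $x^7+x^4+2x$, $\;x^7+e^2x^4+2e^4x$; (iii) $x^7+ex^5+5e^2x^3+6e^3x$.
   Context: A permutation polynomial (PP) over $\mathbb{F}_q$ is a polynomial $f\in\mathbb{F}_q[x]$ whose associated map $a\mapsto f(a)$ is a permutation of $\mathbb{F}_q$. An exceptional polynomial over $\mathbb{F}_q$ is a polynomial in $\mathbb{F}_q[x]$ which is a PP over $\mathbb{F}_{q^m}$ for infinitely many positive integers $m$; non-exceptional means not exceptional. Two polynomials $f,g\in\mathbb{F}_q[x]$ are linearly related if there exist $s,t\in\mathbb{F}_q^*=\mathbb{F}_q\setminus\{0\}$ and $u,v\in\mathbb{F}_q$ with $g(x)=sf(tx+u)+v$. *)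

theory Defs
  imports "HOL-Algebra.Algebraic_Closure_Type" "HOL-Library.Cardinality"
begin

text \<open>
  Writing \<open>q\<close> for the order of the finite field \<open>'a\<close>, the set \<open>ext_field m\<close> (for \<open>m > 0\<close>) is
  the subfield with \<open>q ^ m\<close> elements of the algebraic closure of \<open>'a\<close>. The lemmas below show
  that it contains the image of \<open>'a\<close>, is closed under the field operations, has
  \<open>q ^ m\<close> elements, and is the only subfield of the closure with that many elements.
\<close>

definition ext_field :: "nat \<Rightarrow> 'a :: finite_field alg_closure set" where
  "ext_field m = {x. x ^ (CARD('a) ^ m) = x}"

lemma to_ac_in_ext_field: "to_ac a \<in> ext_field m"
  by (simp add: ext_field_def finite_field_power_card_power_eq_same flip: to_ac_power)

lemma of_nat_card_eq_0: "of_nat CARD('a :: finite_field) = (0 :: 'a)"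
proof -
  have "(\<Sum>x\<in>UNIV. x + 1 :: 'a) = (\<Sum>x\<in>UNIV. x)"
    by (rule sum.reindex_bij_witness[of _ "\<lambda>x. x - 1" "\<lambda>x. x + 1"]) auto
  thus ?thesis by (simp add: sum.distrib)
qed

lemma card_gt_1: "CARD('a :: finite_field) > 1"
  using card_mono[of UNIV "{0, 1 :: 'a}"] by simp

text \<open>
  The polynomial \<open>(X + 1) ^ q - X ^ q - 1\<close> has degree less than \<open>q\<close> and vanishes on
  all of \<open>'a\<close>.
\<close>
lemma of_nat_card_choose_eq_0:
  assumes "0 < k" "k < CARD('a :: finite_field)"
  shows "of_nat (CARD('a) choose k) = (0 :: 'a)"
proof -
  define q where "q = CARD('a)"
  define P :: "'a poly" where "P = (\<Sum>k=1..<q. monom (of_nat (q choose k)) k)"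
  have q: "q > 1" unfolding q_def by (rule card_gt_1)
  have "poly P x = 0" for x
  proof -
    have "(x + 1) ^ q = (\<Sum>k\<le>q. of_nat (q choose k) * x ^ k)"
      by (simp add: binomial_ring)
    also have "{..q} = insert 0 (insert q {1..<q})"
      using q by auto
    also have "(\<Sum>k\<in>\<dots>. of_nat (q choose k) * x ^ k) = 1 + x ^ q + poly P x"
      using q by (simp add: P_def poly_sum poly_monom)
    finally show ?thesis
      using finite_field_power_card_eq_same[of x] finite_field_power_card_eq_same[of "x + 1"]
      by (simp add: q_def)
  qed
  hence roots: "{x. poly P x = 0} = UNIV" by auto
  have "P = 0"
  proof (rule ccontr)
    assume "P \<noteq> 0"
    hence "q \<le> degree P"
      using card_poly_roots_bound[of P] roots by (simp add: q_def)
    moreover have "degree P \<le> q - 1"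
      unfolding P_def by (rule degree_sum_le) (auto intro: order.trans[OF degree_monom_le])
    ultimately show False using q by simp
  qed
  hence "coeff P k = 0" by simp
  thus ?thesis using assms by (simp add: P_def coeff_sum q_def)
qed

lemma add_power_card:
  fixes x y :: "'a :: finite_field alg_closure"
  shows "(x + y) ^ (CARD('a) ^ m) = x ^ (CARD('a) ^ m) + y ^ (CARD('a) ^ m)"
proof (induction m)
  case (Suc m)
  define q where "q = CARD('a)"
  have q: "q > 1" unfolding q_def by (rule card_gt_1)
  have *: "(x + y) ^ q = x ^ q + y ^ q" for x y :: "'a alg_closure"
  proof -
    have "(x + y) ^ q = (\<Sum>k\<le>q. of_nat (q choose k) * x ^ k * y ^ (q - k))"
      by (rule binomial_ring)
    also have "\<dots> = (\<Sum>k\<in>{0, q}. of_nat (q choose k) * x ^ k * y ^ (q - k))"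
    proof (intro sum.mono_neutral_right ballI)
      fix k assume "k \<in> {..q} - {0, q}"
      hence "of_nat (q choose k) = (0 :: 'a)"
        unfolding q_def by (intro of_nat_card_choose_eq_0) auto
      hence "of_nat (q choose k) = (0 :: 'a alg_closure)"
        by (metis to_ac_0 to_ac_of_nat)
      thus "of_nat (q choose k) * x ^ k * y ^ (q - k) = 0" by simp
    qed auto
    finally show ?thesis using q by (simp add: add_ac)
  qed
  have "(x + y) ^ (CARD('a) ^ Suc m) = ((x + y) ^ (CARD('a) ^ m)) ^ q"
    by (simp add: q_def mult.commute flip: power_mult)
  thus ?case
    by (simp add: Suc.IH * mult.commute flip: power_mult) (simp add: q_def)
qed simp

lemma ext_field_0: "0 \<in> ext_field m"
  and ext_field_1: "1 \<in> ext_field m"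
  using to_ac_in_ext_field[of 0] to_ac_in_ext_field[of 1] by simp_all

lemma ext_field_add: "x \<in> ext_field m \<Longrightarrow> y \<in> ext_field m \<Longrightarrow> x + y \<in> ext_field m"
  by (simp add: ext_field_def add_power_card)

lemma ext_field_mult: "x \<in> ext_field m \<Longrightarrow> y \<in> ext_field m \<Longrightarrow> x * y \<in> ext_field m"
  by (simp add: ext_field_def power_mult_distrib)

lemma ext_field_uminus: "x \<in> ext_field m \<Longrightarrow> - x \<in> ext_field m"
  using ext_field_mult[OF to_ac_in_ext_field[of "-1"]] by fastforce

lemma ext_field_inverse: "x \<in> ext_field m \<Longrightarrow> inverse x \<in> ext_field m"
  by (simp add: ext_field_def power_inverse)

lemma card_ext_field:
  assumes "m > 0"
  shows "card (ext_field m :: 'a :: finite_field alg_closure set) = CARD('a) ^ m"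
proof -
  define Q where "Q = CARD('a) ^ m"
  have Q: "Q > 1"
    unfolding Q_def using assms card_gt_1[where 'a = 'a] by (intro one_less_power)
  have Q0: "of_nat Q = (0 :: 'a alg_closure)"
  proof -
    have "of_nat CARD('a) = (0 :: 'a alg_closure)"
      by (metis of_nat_card_eq_0 to_ac_0 to_ac_of_nat)
    thus ?thesis using assms by (simp add: Q_def zero_power)
  qed
  define P :: "'a alg_closure poly" where "P = monom 1 Q - monom 1 1"
  have deg: "degree P = Q"
    unfolding P_def diff_conv_add_uminus using Q
    by (subst degree_add_eq_left) (auto simp: degree_monom_eq)
  have P0: "P \<noteq> 0" using deg Q by auto
  have deriv: "pderiv P = -1"
    by (simp add: P_def pderiv_diff pderiv_monom Q0 monom_0 one_pCons)
  have roots: "{x. poly P x = 0} = ext_field m"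
    by (auto simp: P_def poly_monom ext_field_def Q_def)
  have ord: "count (proots P) x = 1" if "x \<in> ext_field m" for x
  proof -
    have "order x P > 0"
      using that roots P0 by (auto simp: order_gt_0_iff)
    moreover have "\<not> order x P \<ge> 2"
    proof
      assume "order x P \<ge> 2"
      hence "[:-x, 1:] ^ 2 dvd P"
        using order_1[of x P] by (metis le_imp_power_dvd dvd_trans)
      then obtain R where "P = [:-x, 1:] * ([:-x, 1:] * R)"
        by (metis dvdE mult.assoc power2_eq_square)
      hence "poly (pderiv P) x = 0"
        by (simp only: pderiv_mult poly_add poly_mult) simp
      thus False using deriv by simp
    qed
    ultimately show ?thesis using P0 by simp
  qed
  obtain A where A: "size A = degree P" "P = smult (lead_coeff P) (\<Prod>x\<in>#A. [:-x, 1:])"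
    using alg_closed_imp_factorization[OF P0] by blast
  have "proots P = A"
  proof -
    have "proots (\<Prod>x\<in>#A. [:-x, 1 :: 'a alg_closure:]) = A" for A
    proof (induction A)
      case (add x A)
      have "(\<Prod>x\<in>#A. [:-x, 1 :: 'a alg_closure:]) \<noteq> 0"
        by (auto simp: prod_mset_zero_iff)
      thus ?case
        using add by (simp add: proots_mult del: mult_pCons_left)
    qed auto
    thus ?thesis using A(2) P0 by (metis proots_smult smult_eq_0_iff)
  qed
  hence "Q = size (proots P)" using A(1) deg by simp
  also have "\<dots> = (\<Sum>x\<in>set_mset (proots P). count (proots P) x)"
    by (simp add: size_multiset_overloaded_eq)
  also have "set_mset (proots P) = ext_field m"
    using P0 roots by simp
  also have "(\<Sum>x\<in>ext_field m. count (proots P) x) = card (ext_field m :: 'a alg_closure set)"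
    using ord by simp
  finally show ?thesis by (simp add: Q_def)
qed

lemma ext_field_unique:
  fixes K :: "'a :: finite_field alg_closure set"
  assumes "m > 0" and card: "card K = CARD('a) ^ m"
    and K: "0 \<in> K" "\<And>x y. x \<in> K \<Longrightarrow> y \<in> K \<Longrightarrow> x * y \<in> K"
  shows "K = ext_field m"
proof -
  have fin: "finite K"
    using card card_gt_1[where 'a = 'a] by (intro card_ge_0_finite) simp
  have "x ^ card K = x" if x: "x \<in> K" for x
  proof (cases "x = 0")
    case False
    have "inj_on ((*) x) (K - {0})" using False by (auto intro: inj_onI)
    moreover have "(*) x ` (K - {0}) \<subseteq> K - {0}" using K x False by auto
    ultimately have im: "(*) x ` (K - {0}) = K - {0}"
      using fin by (intro endo_inj_surj) auto
    have "\<Prod>(K - {0}) = \<Prod>((*) x ` (K - {0}))" by (simp only: im)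
    also have "\<dots> = (\<Prod>y\<in>K - {0}. x * y)"
      using False by (subst prod.reindex) (auto intro: inj_onI)
    also have "\<dots> = x ^ card (K - {0}) * \<Prod>(K - {0})"
      by (simp add: prod.distrib)
    finally have "x ^ card (K - {0}) = 1"
      using fin by simp
    moreover have "card K = Suc (card (K - {0}))"
      using fin K(1) by (rule card.remove)
    ultimately show ?thesis by simp
  qed (use card card_gt_1[where 'a = 'a] in \<open>simp add: zero_power\<close>)
  hence "K \<subseteq> ext_field m" by (auto simp: ext_field_def card)
  moreover have "finite (ext_field m :: 'a alg_closure set)"
    using card_ext_field[OF \<open>m > 0\<close>, where 'a = 'a] card_gt_1[where 'a = 'a]
    by (intro card_ge_0_finite) simp
  ultimately show ?thesis
    using card_ext_field[OF \<open>m > 0\<close>, where 'a = 'a] card by (intro card_subset_eq) auto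
qed


definition permutation_polynomial :: "'a :: finite_field poly \<Rightarrow> bool" where
  "permutation_polynomial f \<longleftrightarrow> bij (poly f)"

definition permutation_polynomial_ext :: "nat \<Rightarrow> 'a :: finite_field poly \<Rightarrow> bool" where
  "permutation_polynomial_ext m f \<longleftrightarrow>
     bij_betw (poly (map_poly to_ac f)) (ext_field m) (ext_field m)"

definition exceptional :: "'a :: finite_field poly \<Rightarrow> bool" where
  "exceptional f \<longleftrightarrow> infinite {m. m > 0 \<and> permutation_polynomial_ext m f}"

definition linearly_related :: "'a :: finite_field poly \<Rightarrow> 'a poly \<Rightarrow> bool" where
  "linearly_related f g \<longleftrightarrow>
     (\<exists>s t u v. s \<noteq> 0 \<and> t \<noteq> 0 \<and> g = smult s (f \<circ>\<^sub>p [:u, t:]) + [:v:])"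

end

theory Submission
  imports Defs
begin

text \<open>
  Up to linear equivalence a permutation polynomial of degree \<open>7\<close> is
  \<open>f = x^7 + a\<^sub>5 x^5 + a\<^sub>4 x^4 + a\<^sub>3 x^3 + a\<^sub>2 x^2 + a\<^sub>1 x\<close>, where a shift makes \<open>a\<^sub>4 = 0\<close> if
  \<open>a\<^sub>5 \<noteq> 0\<close>, and \<open>a\<^sub>3 = 0\<close> if \<open>a\<^sub>5 = 0 \<noteq> a\<^sub>4\<close>. Hermite's criterion for the powers \<open>f^k\<close> with
  \<open>k \<in> {8, 10, 11, 12, 16}\<close>, whose coefficients are computed with the Frobenius map from those
  of small powers, and a few explicit collisions \<open>f x = f y\<close> leave finitely many polynomials
  up to scaling \<open>x\<close>. All but one of them
  are of the form \<open>x (x^k + b)^r\<close> with \<open>k r = 6\<close>. Such a polynomial is injective on any extension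
  in which \<open>-b\<close> is not a \<open>k\<close>-th power, and this property persists in extensions of degree
  \<open>m \<equiv> 1\<close> modulo \<open>48\<close>. The remaining one violates Hermite's criterion in every proper
  extension, with exponent \<open>24 + 49 \<cdot> (49^(m-1) - 1) / 3\<close>.
\<close>

section \<open>Hermite's criterion\<close>

lemma add_power_7:
  fixes x y :: "'b :: comm_ring_1"
  assumes "(7 :: 'b) = 0"
  shows "(x + y) ^ 7 = x ^ 7 + y ^ 7"
proof -
  have "(x + y) ^ 7 = x ^ 7 + y ^ 7 +
    7 * (x^6*y + 3*x^5*y^2 + 5*x^4*y^3 + 5*x^3*y^4 + 3*x^2*y^5 + x*y^6)"
    by (simp add: eval_nat_numeral algebra_simps)
  thus ?thesis using assms by simp
qed

text \<open>The hypothesis is additivity of the \<open>q\<close>-th power instead of a prime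
  characteristic \<open>q\<close>, so that \<open>q = 7\<close> and \<open>q = 49\<close> are both
  covered. The induction splits off the constant term:
  \<open>(a + X * p) ^ q = a ^ q + X ^ q * p ^ q\<close>.\<close>

lemma coeff_power_additive:
  fixes r :: "'b :: comm_ring_1 poly"
  assumes add: "\<And>x y :: 'b poly. (x + y) ^ q = x ^ q + y ^ q" and q: "q > 0"
  shows "coeff (r ^ q) n = (if q dvd n then coeff r (n div q) ^ q else 0)"
proof (induction r arbitrary: n)
  case 0
  thus ?case using q by (simp add: zero_power)
next
  case (pCons a p)
  have "pCons a p = [:a:] + monom 1 1 * p"
    by (simp add: monom_altdef)
  hence "pCons a p ^ q = [:a ^ q:] + monom 1 q * p ^ q"
    by (simp add: add power_mult_distrib monom_power flip: poly_const_pow)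
  hence *: "coeff (pCons a p ^ q) n = coeff [:a ^ q:] n + (if n < q then 0 else coeff (p ^ q) (n - q))"
    by (simp add: coeff_monom_mult)
  show ?case
  proof (cases "n < q")
    case True
    hence "q dvd n \<longleftrightarrow> n = 0" using q by (auto dest: dvd_imp_le)
    thus ?thesis using True q unfolding * by (cases n) (auto simp: coeff_pCons)
  next
    case False
    then obtain k where k: "n = q + k" by (metis le_Suc_ex not_less)
    have "coeff [:a ^ q:] n = 0" using q False by (cases n) (auto simp: coeff_pCons)
    thus ?thesis using q False unfolding * pCons.IH by (simp add: k)
  qed
qed

text \<open>Only multiples of \<open>q\<close> contribute to the convolution. With
  \<open>p = f ^ i\<close> and \<open>r = f ^ k\<close> this yields coefficients of
  \<open>f ^ (i + q * k)\<close> from those of much smaller powers.\<close>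

lemma coeff_mult_power_additive:
  fixes p r :: "'b :: comm_ring_1 poly"
  assumes add: "\<And>x y :: 'b poly. (x + y) ^ q = x ^ q + y ^ q" and q: "q > 0"
  shows "coeff (p * r ^ q) n = (\<Sum>j\<le>n div q. coeff p (n - q * j) * coeff r j ^ q)"
proof -
  have "coeff (p * r ^ q) n = (\<Sum>i\<le>n. coeff (r ^ q) i * coeff p (n - i))"
    by (subst mult.commute) (rule coeff_mult)
  also have "\<dots> = (\<Sum>i\<in>(\<lambda>j. q * j) ` {..n div q}. coeff (r ^ q) i * coeff p (n - i))"
  proof (rule sum.mono_neutral_right)
    show "(\<lambda>j. q * j) ` {..n div q} \<subseteq> {..n}"
      using q by (auto simp: less_eq_div_iff_mult_less_eq mult.commute)
    show "\<forall>i\<in>{..n} - (\<lambda>j. q * j) ` {..n div q}. coeff (r ^ q) i * coeff p (n - i) = 0"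
    proof
      fix i assume i: "i \<in> {..n} - (\<lambda>j. q * j) ` {..n div q}"
      hence "\<not> q dvd i" using q by (auto elim!: dvdE simp: less_eq_div_iff_mult_less_eq mult.commute)
      thus "coeff (r ^ q) i * coeff p (n - i) = 0"
        by (simp add: coeff_power_additive[OF assms])
    qed
  qed auto
  also have "\<dots> = (\<Sum>j\<le>n div q. coeff (r ^ q) (q * j) * coeff p (n - q * j))"
    using q by (subst sum.reindex) (auto intro: inj_onI)
  finally show ?thesis
    using q by (simp add: coeff_power_additive[OF assms] mult.commute)
qed

text \<open>If \<open>Q - 1\<close> divides \<open>n > 0\<close>, every nonzero element contributes
  1, and \<open>Q - 1\<close> equals -1 in the field. If \<open>Q - 1\<close> does not divide
  \<open>n\<close>, multiplication by some \<open>c\<close> with \<open>c ^ n \<noteq> 1\<close>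
  permutes the field and multiplies the sum by \<open>c ^ n\<close>. For \<open>n = 0\<close> the
  sum is \<open>Q = 0\<close>, as \<open>0 ^ 0 = 1\<close>.\<close>

lemma sum_power_ext_field:
  fixes n :: nat
  assumes m: "m > 0"
  defines "Q \<equiv> CARD('a :: finite_field) ^ m"
  shows "(\<Sum>x\<in>(ext_field m :: 'a alg_closure set). x ^ n) = (if n > 0 \<and> Q - 1 dvd n then -1 else 0)"
proof -
  define K :: "'a alg_closure set" where "K = ext_field m"
  have Q: "Q > 1"
    unfolding Q_def using m card_gt_1[where 'a = 'a] by (intro one_less_power)
  have cardK: "card K = Q" unfolding K_def Q_def using m by (rule card_ext_field)
  have fin: "finite K" using cardK Q by (intro card_ge_0_finite) simp
  have K0: "0 \<in> K" unfolding K_def by (rule ext_field_0)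
  have mult: "x * y \<in> K" if "x \<in> K" "y \<in> K" for x y
    using that unfolding K_def by (rule ext_field_mult)
  have unit: "x ^ (Q - 1) = 1" if "x \<in> K" "x \<noteq> 0" for x
  proof -
    have "x ^ (Q - 1) * x = x"
      using that Q by (simp add: K_def ext_field_def Q_def flip: power_Suc2)
    thus ?thesis using that by simp
  qed
  have Q0: "of_nat Q = (0 :: 'a alg_closure)"
  proof -
    have "of_nat CARD('a) = (0 :: 'a alg_closure)"
      by (metis of_nat_card_eq_0 to_ac_0 to_ac_of_nat)
    thus ?thesis using m by (simp add: Q_def zero_power)
  qed
  have split: "(\<Sum>x\<in>K. x ^ n) = 0 ^ n + (\<Sum>x\<in>K - {0}. x ^ n)"
    using fin K0 by (rule sum.remove)
  show ?thesis
  proof (cases "Q - 1 dvd n")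
    case True
    have "x ^ n = 1" if "x \<in> K - {0}" for x
      using True unit[of x] that by (auto elim!: dvdE simp: power_mult)
    hence "(\<Sum>x\<in>K - {0}. x ^ n) = (\<Sum>x\<in>K - {0}. 1)" by (intro sum.cong) auto
    also have "\<dots> = of_nat (Q - 1)" using fin K0 cardK by simp
    also have "\<dots> = -1" using Q Q0 by (simp add: of_nat_diff)
    finally have "(\<Sum>x\<in>K. x ^ n) = 0 ^ n + (- 1)" using split by simp
    thus ?thesis using True unfolding K_def[symmetric] by (cases "n = 0") (auto simp: zero_power)
  next
    case False
    define r where "r = n mod (Q - 1)"
    have r: "0 < r" "r < Q - 1" using False Q by (auto simp: r_def dvd_eq_mod_eq_0)
    \<comment> \<open>The polynomial \<open>X ^ r - 1\<close> has at most \<open>r < Q - 1\<close>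
      roots, too few for all nonzero elements.\<close>
    have "\<exists>c\<in>K - {0}. c ^ r \<noteq> 1"
    proof (rule ccontr)
      assume "\<not> (\<exists>c\<in>K - {0}. c ^ r \<noteq> 1)"
      hence sub: "K - {0} \<subseteq> {x. poly (monom 1 r - 1) x = 0}" by (auto simp: poly_monom)
      have deg: "degree (monom 1 r - 1 :: 'a alg_closure poly) = r"
        unfolding diff_conv_add_uminus using r
        by (subst degree_add_eq_left) (auto simp: degree_monom_eq)
      hence nz: "(monom 1 r - 1 :: 'a alg_closure poly) \<noteq> 0" using r by auto
      have "Q - 1 = card (K - {0})" using fin K0 cardK by simp
      also have "\<dots> \<le> card {x. poly (monom 1 r - 1) x = (0 :: 'a alg_closure)}"
        by (intro card_mono sub poly_roots_finite nz)
      also have "\<dots> \<le> r" using card_poly_roots_bound[OF nz] deg by simp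
      finally show False using r by simp
    qed
    then obtain c where c: "c \<in> K" "c \<noteq> 0" "c ^ r \<noteq> 1" by auto
    have "c ^ n = c ^ ((Q - 1) * (n div (Q - 1)) + r)" by (simp add: r_def)
    hence cn: "c ^ n \<noteq> 1" using c unit[of c] by (simp add: power_add power_mult)
    have "inj_on ((*) c) K" using c by (auto intro: inj_onI)
    moreover have "(*) c ` K \<subseteq> K" using mult c by auto
    ultimately have im: "(*) c ` K = K" using fin by (intro endo_inj_surj)
    have "(\<Sum>x\<in>K. x ^ n) = (\<Sum>x\<in>(*) c ` K. x ^ n)" by (simp only: im)
    also have "\<dots> = c ^ n * (\<Sum>x\<in>K. x ^ n)"
      using c by (subst sum.reindex) (auto intro: inj_onI simp: power_mult_distrib sum_distrib_left)
    finally have "(\<Sum>x\<in>K. x ^ n) = 0" using cn by simp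
    thus ?thesis using False by (simp add: K_def)
  qed
qed

lemma map_poly_to_ac_mult: "map_poly to_ac (p * q) = map_poly to_ac p * map_poly to_ac q"
  by (rule poly_eqI) (simp add: coeff_map_poly coeff_mult to_ac_sum)

lemma map_poly_to_ac_power: "map_poly to_ac (p ^ n) = map_poly to_ac p ^ n"
  by (induction n) (simp_all add: map_poly_to_ac_mult)

text \<open>The sum of \<open>f(x) ^ k\<close> over the field with \<open>Q\<close> elements is
  computed twice. Since \<open>f\<close> permutes the field, it is a power sum with exponent
  \<open>0 < k < Q - 1\<close>, hence 0. Expanding \<open>f ^ k\<close> gives minus the sum of its
  coefficients at positive multiples of \<open>Q - 1\<close>, and the degree bound admits only the
  first two of these.\<close>

lemma hermite:
  fixes f :: "'a :: finite_field poly"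
  assumes m: "m > 0" and pp: "permutation_polynomial_ext m f"
  defines "Q \<equiv> CARD('a) ^ m"
  assumes k: "0 < k" "k < Q - 1" and deg: "degree f * k < 3 * (Q - 1)"
  shows "coeff (f ^ k) (Q - 1) + coeff (f ^ k) (2 * (Q - 1)) = 0"
proof -
  define K :: "'a alg_closure set" where "K = ext_field m"
  define N where "N = Q - 1"
  define P where "P = f ^ k"
  have P: "degree P < 3 * N"
    using deg degree_power_le[of f k] by (simp add: P_def N_def)
  have ev: "poly (map_poly to_ac f) x ^ k = poly (map_poly to_ac P) x" for x
    by (simp add: P_def map_poly_to_ac_power)
  have N: "N > 0" using k by (simp add: N_def)
  have S: "(\<Sum>x\<in>K. x ^ n) = (if n > 0 \<and> N dvd n then -1 else 0)" for n
    using sum_power_ext_field[OF m, where 'a = 'a, of n] by (simp add: K_def N_def Q_def)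
  have "(\<Sum>x\<in>K. poly (map_poly to_ac f) x ^ k) = (\<Sum>y\<in>K. y ^ k)"
    using pp unfolding permutation_polynomial_ext_def K_def
    by (rule sum.reindex_bij_betw)
  also have "\<dots> = 0" using S[of k] k by (auto simp: N_def dest: dvd_imp_le)
  finally have "0 = (\<Sum>x\<in>K. poly (map_poly to_ac P) x)" by (simp add: ev)
  also have "\<dots> = (\<Sum>x\<in>K. \<Sum>n<3*N. to_ac (coeff P n) * x ^ n)"
  proof (rule sum.cong[OF refl])
    fix x :: "'a alg_closure"
    have "poly (map_poly to_ac P) x = (\<Sum>n\<le>degree P. to_ac (coeff P n) * x ^ n)"
      by (simp add: poly_altdef coeff_map_poly degree_map_poly)
    also have "\<dots> = (\<Sum>n<3*N. to_ac (coeff P n) * x ^ n)"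
      using P by (intro sum.mono_neutral_left) (auto simp: coeff_eq_0)
    finally show "poly (map_poly to_ac P) x = (\<Sum>n<3*N. to_ac (coeff P n) * x ^ n)" .
  qed
  also have "\<dots> = (\<Sum>n<3*N. to_ac (coeff P n) * (\<Sum>x\<in>K. x ^ n))"
    by (subst sum.swap) (simp add: sum_distrib_left)
  also have "\<dots> = (\<Sum>n\<in>{N, 2 * N}. to_ac (coeff P n) * (\<Sum>x\<in>K. x ^ n))"
  proof (rule sum.mono_neutral_right)
    show "\<forall>n\<in>{..<3*N} - {N, 2*N}. to_ac (coeff P n) * (\<Sum>x\<in>K. x ^ n) = 0"
    proof
      fix n assume n: "n \<in> {..<3*N} - {N, 2*N}"
      have "\<not> (n > 0 \<and> N dvd n)"
      proof
        assume "n > 0 \<and> N dvd n"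
        then obtain j where j: "n = N * j" "j > 0" by (auto elim!: dvdE)
        hence "j < 3" using n by auto
        hence "j = 1 \<or> j = 2" using j by auto
        thus False using n j by auto
      qed
      thus "to_ac (coeff P n) * (\<Sum>x\<in>K. x ^ n) = 0"
        by (simp only: S if_False mult_zero_right)
    qed
  qed (use N in auto)
  also have "\<dots> = - to_ac (coeff P N + coeff P (2 * N))"
    using N by (simp add: S)
  finally have "to_ac (coeff P N + coeff P (2 * N)) = 0" by (metis neg_0_equal_iff_equal)
  thus ?thesis by (simp only: to_ac_eq_0_iff P_def N_def)
qed

section \<open>Powers of septic normal forms\<close>

lemma coeff_pCons_numeral:
  "coeff (pCons a p) 0 = a"
  "coeff (pCons a p) 1 = coeff p 0"
  "coeff (pCons a p) (numeral n) = coeff p (pred_numeral n)"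
  by (simp_all add: numeral_eq_Suc)

text \<open>Recursion on the first factor evaluates one coefficient of a product of explicit
  polynomials without expanding the product.\<close>

lemma coeff_pCons_mult_numeral:
  fixes a :: "'b :: comm_ring_1"
  shows "coeff (pCons a p * q) 0 = a * coeff q 0"
    and "coeff (pCons a p * q) 1 = a * coeff q 1 + coeff (p * q) 0"
    and "coeff (pCons a p * q) (numeral n) = a * coeff q (numeral n) + coeff (p * q) (pred_numeral n)"
  by (simp_all add: numeral_eq_Suc)

lemmas coeff_mult_simps = coeff_pCons_numeral coeff_pCons_mult_numeral coeff_0
  mult_zero_left mult_zero_right add_0_right add_0_left mult_1_right mult_1_left
  pred_numeral_simps numeral_One BitM.simps

definition normal_form :: "'b \<Rightarrow> 'b \<Rightarrow> 'b \<Rightarrow> 'b \<Rightarrow> 'b \<Rightarrow> 'b :: comm_ring_1 poly" where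
  "normal_form a\<^sub>5 a\<^sub>4 a\<^sub>3 a\<^sub>2 a\<^sub>1 = [:0, a\<^sub>1, a\<^sub>2, a\<^sub>3, a\<^sub>4, a\<^sub>5, 0, 1:]"

lemma degree_normal_form [simp]: "degree (normal_form a\<^sub>5 a\<^sub>4 a\<^sub>3 a\<^sub>2 a\<^sub>1) = 7"
  by (simp add: normal_form_def)

text \<open>Powers are expanded for two shapes that a shift can achieve:
  \<open>a\<^sub>4 = 0\<close> here, and \<open>a\<^sub>5 = a\<^sub>3 = 0\<close> in the primed
  versions.\<close>

lemma normal_form_power2:
  "normal_form a 0 b c d ^ 2 =
    [:0, 0, d^2, 2*c*d, 2*b*d + c^2, 2*b*c, 2*a*d + b^2, 2*a*c, 2*d + 2*a*b, 2*c, a^2 + 2*b,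
      0, 2*a, 0, 1:]"
  by (simp add: normal_form_def power2_eq_square algebra_simps)

lemma normal_form_power3:
  "normal_form a 0 b c d ^ 3 =
    [:0, 0, 0, d^3, 3*c*d^2, 3*b*d^2 + 3*c^2*d, 6*b*c*d + c^3, 3*a*d^2 + 3*b^2*d + 3*b*c^2,
      6*a*c*d + 3*b^2*c, 6*a*b*d + 3*a*c^2 + b^3 + 3*d^2, 6*a*b*c + 6*c*d,
      3*a^2*d + 3*a*b^2 + 6*b*d + 3*c^2, 3*a^2*c + 6*b*c, 3*a^2*b + 6*a*d + 3*b^2, 6*a*c,
      a^3 + 6*a*b + 3*d, 3*c, 3*a^2 + 3*b, 0, 3*a, 0, 1:]"
  unfolding power3_eq_cube normal_form_def
  by (simp add: algebra_simps power2_eq_square power3_eq_cube)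

lemma normal_form_power2':
  "normal_form 0 a 0 c d ^ 2 =
    [:0, 0, d^2, 2*c*d, c^2, 2*a*d, 2*a*c, 0, 2*d + a^2, 2*c, 0, 2*a, 0, 0, 1:]"
  by (simp add: normal_form_def power2_eq_square algebra_simps)

text \<open>The indices 13, 20, 27 and 34 that occur here and below are \<open>48 - 7 * i\<close>
  for \<open>i = 5, 4, 3, 2\<close>. They accompany the seventh power of the coefficient of
  \<open>x^i\<close> in Hermite's criterion for the exponents 11 and 12.\<close>

lemma coeff_normal_form_power4:
  "coeff (normal_form a 0 b c d ^ 4) 13 = 24*b*c*d + 4*c^3 + 12*a^2*c*d + 12*a*b^2*c"
  "coeff (normal_form a 0 b c d ^ 4) 27 = 0"
proof -
  have *: "normal_form a 0 b c d ^ 4 = normal_form a 0 b c d ^ 2 * normal_form a 0 b c d ^ 2"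
    by (simp flip: power_add)
  show "coeff (normal_form a 0 b c d ^ 4) 13 = 24*b*c*d + 4*c^3 + 12*a^2*c*d + 12*a*b^2*c"
    unfolding * normal_form_power2
    by (simp only: coeff_mult_simps) (simp add: eval_nat_numeral algebra_simps)
  show "coeff (normal_form a 0 b c d ^ 4) 27 = 0"
    unfolding * normal_form_power2 by (simp only: coeff_mult_simps)
qed

lemma coeff_normal_form_power5:
  "coeff (normal_form a 0 b c d ^ 5) 13 =
     20*b*d^3 + 10*a^2*d^3 + 30*a*b^2*d^2 + 5*b^4*d
     + c^2*(30*d^2 + 60*a*b*d + 10*b^3) + 5*a*c^4"
  "coeff (normal_form a 0 b c d ^ 5) 27 = 20*a*d + 10*b^2 + 30*a^2*b + 5*a^4"
  "coeff (normal_form a 0 b c d ^ 5) 34 = 0"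
proof -
  have *: "normal_form a 0 b c d ^ 5 = normal_form a 0 b c d ^ 2 * normal_form a 0 b c d ^ 3"
    by (simp flip: power_add)
  show "coeff (normal_form a 0 b c d ^ 5) 13 =
      20*b*d^3 + 10*a^2*d^3 + 30*a*b^2*d^2 + 5*b^4*d
      + c^2*(30*d^2 + 60*a*b*d + 10*b^3) + 5*a*c^4"
    unfolding * normal_form_power2 normal_form_power3
    by (simp only: coeff_mult_simps) (simp add: eval_nat_numeral algebra_simps)
  show "coeff (normal_form a 0 b c d ^ 5) 27 = 20*a*d + 10*b^2 + 30*a^2*b + 5*a^4"
    unfolding * normal_form_power2 normal_form_power3
    by (simp only: coeff_mult_simps) (simp add: eval_nat_numeral algebra_simps)
  show "coeff (normal_form a 0 b c d ^ 5) 34 = 0"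
    unfolding * normal_form_power2 normal_form_power3 by (simp only: coeff_mult_simps)
qed

lemma coeff_normal_form_power4':
  "coeff (normal_form 0 a 0 c d ^ 4) 20 = 12*a*c"
proof -
  have *: "normal_form 0 a 0 c d ^ 4 = normal_form 0 a 0 c d ^ 2 * normal_form 0 a 0 c d ^ 2"
    by (simp flip: power_add)
  show ?thesis
    unfolding * normal_form_power2'
    by (simp only: coeff_mult_simps) (simp add: eval_nat_numeral algebra_simps)
qed

lemma coeff_normal_form_power5':
  "coeff (normal_form 0 a 0 c d ^ 5) 20 = 30*a*d^2 + 20*a^3*d + a^5 + 10*c^3"
proof -
  have *: "normal_form 0 a 0 c d ^ 5 =
      normal_form 0 a 0 c d * (normal_form 0 a 0 c d ^ 2 * normal_form 0 a 0 c d ^ 2)"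
    by (simp flip: power_add power_Suc)
  show ?thesis
    unfolding * normal_form_power2' unfolding normal_form_def
    by (simp only: coeff_mult_simps) (simp add: eval_nat_numeral algebra_simps)
qed

section \<open>Linear equivalence\<close>

lemma ext_field_1_eq_range: "ext_field 1 = range (to_ac :: 'a :: finite_field \<Rightarrow> _)"
proof (rule card_subset_eq[symmetric])
  have "card (ext_field 1 :: 'a alg_closure set) = CARD('a)"
    using card_ext_field[of 1, where 'a = 'a] by simp
  thus "finite (ext_field 1 :: 'a alg_closure set)"
    using card_gt_1[where 'a = 'a] by (intro card_ge_0_finite) simp
  show "range (to_ac :: 'a \<Rightarrow> _) \<subseteq> ext_field 1" using to_ac_in_ext_field by blast
  show "card (range (to_ac :: 'a \<Rightarrow> _)) = card (ext_field 1 :: 'a alg_closure set)"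
    using card_ext_field[of 1, where 'a = 'a] by (simp add: card_image inj_to_ac)
qed

lemma poly_map_poly_to_ac: "poly (map_poly to_ac f) (to_ac x) = to_ac (poly f x)"
  by (induction f) (simp_all add: map_poly_pCons)

lemma permutation_polynomial_imp_ext_1:
  fixes f :: "'a :: finite_field poly"
  assumes "permutation_polynomial f"
  shows "permutation_polynomial_ext 1 f"
proof -
  have f: "inj (poly f)" "surj (poly f)"
    using assms by (simp_all add: permutation_polynomial_def bij_def)
  have "inj_on (poly (map_poly to_ac f)) (range to_ac)"
    using f(1) by (auto simp: inj_on_def poly_map_poly_to_ac)
  moreover have "poly (map_poly to_ac f) ` range to_ac = to_ac ` range (poly f)"
    by (simp add: image_image poly_map_poly_to_ac)
  ultimately show ?thesis
    using f(2) by (simp add: permutation_polynomial_ext_def bij_betw_def ext_field_1_eq_range[simplified])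
qed

text \<open>A single extension suffices: injectivity there restricts to the base field, which is
  finite.\<close>

lemma exceptional_imp_permutation_polynomial:
  assumes "exceptional (f :: 'a :: finite_field poly)"
  shows "permutation_polynomial f"
proof -
  obtain m where "permutation_polynomial_ext m f"
    using assms unfolding exceptional_def by (metis (mono_tags, lifting) finite.emptyI mem_Collect_eq equals0I)
  hence inj: "inj_on (poly (map_poly to_ac f)) (ext_field m)"
    by (simp add: permutation_polynomial_ext_def bij_betw_def)
  have "inj (poly f)"
  proof (rule injI)
    fix x y assume "poly f x = poly f y"
    hence "poly (map_poly to_ac f) (to_ac x) = poly (map_poly to_ac f) (to_ac y)"
      by (simp add: poly_map_poly_to_ac)
    hence "to_ac x = to_ac y" using inj to_ac_in_ext_field by (metis inj_onD)
    thus "x = y" by simp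
  qed
  thus ?thesis by (simp add: permutation_polynomial_def bij_def finite_UNIV_inj_surj)
qed

lemma linearly_related_sym:
  assumes "linearly_related f g"
  shows "linearly_related g f"
proof -
  obtain s t u v where st: "s \<noteq> 0" "t \<noteq> 0" and g: "g = smult s (f \<circ>\<^sub>p [:u, t:]) + [:v:]"
    using assms by (auto simp: linearly_related_def)
  have "g \<circ>\<^sub>p [:- u / t, 1 / t:] = smult s (f \<circ>\<^sub>p ([:u, t:] \<circ>\<^sub>p [:- u / t, 1 / t:])) + [:v:]"
    by (simp add: g pcompose_add pcompose_smult pcompose_const flip: pcompose_assoc)
  also have "[:u, t:] \<circ>\<^sub>p [:- u / t, 1 / t:] = [:0, 1:]"
    using st by (simp add: pcompose_pCons)
  finally have "f = smult (1 / s) (g \<circ>\<^sub>p [:- u / t, 1 / t:]) + [:- v / s:]"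
    using st by (simp add: smult_add_right)
  thus ?thesis unfolding linearly_related_def using st
    by (intro exI[of _ "1 / s"] exI[of _ "1 / t"] exI[of _ "- u / t"] exI[of _ "- v / s"]) simp
qed

lemma linearly_related_trans [trans]:
  assumes "linearly_related f g" "linearly_related g h"
  shows "linearly_related f h"
proof -
  obtain s t u v where st: "s \<noteq> 0" "t \<noteq> 0" and g: "g = smult s (f \<circ>\<^sub>p [:u, t:]) + [:v:]"
    using assms(1) by (auto simp: linearly_related_def)
  obtain s' t' u' v' where st': "s' \<noteq> 0" "t' \<noteq> 0"
    and h: "h = smult s' (g \<circ>\<^sub>p [:u', t':]) + [:v':]"
    using assms(2) by (auto simp: linearly_related_def)
  have "h = smult (s' * s) (f \<circ>\<^sub>p [:u + t * u', t * t':]) + [:s' * v + v':]"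
    unfolding h g
    by (simp add: pcompose_add pcompose_smult pcompose_const smult_add_right pcompose_pCons
        flip: pcompose_assoc)
  thus ?thesis unfolding linearly_related_def using st st'
    by (intro exI[of _ "s' * s"] exI[of _ "t * t'"] exI[of _ "u + t * u'"]
        exI[of _ "s' * v + v'"]) simp
qed

lemma map_poly_to_ac_add: "map_poly to_ac (p + q) = map_poly to_ac p + map_poly to_ac q"
  by (rule poly_eqI) (simp add: coeff_map_poly)

lemma map_poly_to_ac_pcompose:
  "map_poly to_ac (p \<circ>\<^sub>p q) = map_poly to_ac p \<circ>\<^sub>p map_poly to_ac q"
  by (induction p)
     (simp_all add: map_poly_pCons pcompose_pCons map_poly_to_ac_add map_poly_to_ac_mult)

lemma bij_betw_affine_ext_field:
  fixes t u :: "'a :: finite_field"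
  assumes "m > 0" "t \<noteq> 0"
  shows "bij_betw (\<lambda>x. to_ac u + to_ac t * x) (ext_field m) (ext_field m)"
proof -
  have "card (ext_field m :: 'a alg_closure set) > 0"
    using card_ext_field[OF \<open>m > 0\<close>, where 'a = 'a] card_gt_1[where 'a = 'a] by simp
  hence fin: "finite (ext_field m :: 'a alg_closure set)" by (rule card_ge_0_finite)
  have "inj_on (\<lambda>x. to_ac u + to_ac t * x) (ext_field m)" using assms by (auto intro: inj_onI)
  moreover have "(\<lambda>x. to_ac u + to_ac t * x) ` ext_field m \<subseteq> ext_field m"
    by (auto intro: ext_field_add ext_field_mult to_ac_in_ext_field)
  ultimately show ?thesis using fin by (simp add: bij_betw_def endo_inj_surj)
qed

lemma permutation_polynomial_ext_linearly_related:
  fixes f g :: "'a :: finite_field poly"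
  assumes "linearly_related f g" and m: "m > 0" and pp: "permutation_polynomial_ext m f"
  shows "permutation_polynomial_ext m g"
proof -
  obtain s t u v where st: "s \<noteq> 0" "t \<noteq> 0" and g: "g = smult s (f \<circ>\<^sub>p [:u, t:]) + [:v:]"
    using assms(1) by (auto simp: linearly_related_def)
  have "poly (map_poly to_ac g) =
      (\<lambda>x. to_ac v + to_ac s * x) \<circ> poly (map_poly to_ac f) \<circ> (\<lambda>x. to_ac u + to_ac t * x)"
  proof
    fix x
    have "g = [:s:] * (f \<circ>\<^sub>p [:u, t:]) + [:v:]" by (simp add: g)
    thus "poly (map_poly to_ac g) x = ((\<lambda>x. to_ac v + to_ac s * x) \<circ>
        poly (map_poly to_ac f) \<circ> (\<lambda>x. to_ac u + to_ac t * x)) x"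
      by (simp only: map_poly_to_ac_add map_poly_to_ac_mult map_poly_to_ac_pcompose)
         (simp add: map_poly_pCons poly_pcompose mult.commute)
  qed
  thus ?thesis
    using pp st m unfolding permutation_polynomial_ext_def
    by (auto intro!: bij_betw_trans bij_betw_affine_ext_field simp: o_assoc[symmetric])
qed

lemma exceptional_linearly_related:
  assumes "linearly_related f g" "exceptional f"
  shows "exceptional g"
proof -
  have "{m. m > 0 \<and> permutation_polynomial_ext m f} \<subseteq> {m. m > 0 \<and> permutation_polynomial_ext m g}"
    using permutation_polynomial_ext_linearly_related[OF assms(1)] by blast
  thus ?thesis using assms(2) unfolding exceptional_def by (metis finite_subset)
qed

section \<open>Exceptional polynomials over the field with 49 elements\<close>

lemma seven_poly: "(7 :: 'b :: comm_ring_1) = 0 \<Longrightarrow> (7 :: 'b poly) = 0"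
  by (metis numeral_poly pCons_0_0)

text \<open>
  If \<open>w = x (x^k + b)^r\<close>, then \<open>p = x^k + b\<close> satisfies \<open>w^k = (p - b) p^6\<close>, so \<open>1/p\<close> is a root of
  \<open>w^k T^7 + b T - 1\<close>. This is an affine polynomial in characteristic \<open>7\<close>, so the difference of
  two distinct roots is a root of \<open>w^k T^6 + b\<close>, and \<open>-b\<close> is the \<open>k\<close>-th power of \<open>w T^r\<close>.
\<close>
lemma mult_power_eq_imp_eq:
  fixes x y b :: "'b :: field"
  assumes seven: "(7 :: 'b) = 0" and kr: "k * r = 6"
    and eq: "x * (x ^ k + b) ^ r = y * (y ^ k + b) ^ r"
    and not_root: "x ^ k \<noteq> - b" "y ^ k \<noteq> - b"
    and not_power: "\<And>i. (x * (x ^ k + b) ^ r * (inverse (x ^ k + b) - inverse (y ^ k + b)) ^ i) ^ k \<noteq> - b"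
  shows "x = y"
proof -
  define w where "w = x * (x ^ k + b) ^ r"
  define p where "p = x ^ k + b"
  define q where "q = y ^ k + b"
  have pq: "p \<noteq> 0" "q \<noteq> 0" using not_root by (simp_all add: p_def q_def eq_neg_iff_add_eq_0)
  have wx: "w = x * p ^ r" and wy: "w = y * q ^ r" using eq by (simp_all add: w_def p_def q_def)
  have *: "w ^ k * inverse z ^ 7 = 1 - b * inverse z" if "w = u * z ^ r" "z = u ^ k + b" "z \<noteq> 0" for u z
  proof -
    have "w ^ k = (z - b) * z ^ 6"
      using that by (simp add: power_mult_distrib kr mult.commute flip: power_mult)
    thus ?thesis using \<open>z \<noteq> 0\<close> by (simp add: field_simps eval_nat_numeral)
  qed
  have "w ^ k * (inverse p - inverse q) ^ 7 = w ^ k * inverse p ^ 7 - w ^ k * inverse q ^ 7"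
    using add_power_7[OF seven, of "inverse p - inverse q" "inverse q"] by (simp add: algebra_simps)
  also have "\<dots> = - b * (inverse p - inverse q)"
    using *[OF wx p_def pq(1)] *[OF wy q_def pq(2)] by (simp add: algebra_simps)
  finally have "w ^ k * (inverse p - inverse q) ^ 6 * (inverse p - inverse q) =
      - b * (inverse p - inverse q)"
    by (simp add: eval_nat_numeral mult_ac)
  moreover have "w ^ k * (inverse p - inverse q) ^ 6 \<noteq> - b"
    using not_power[of r] by (simp add: p_def q_def w_def power_mult_distrib kr mult.commute flip: power_mult)
  ultimately have "inverse p - inverse q = 0" by (metis mult_cancel_right)
  hence "p = q" by simp
  thus ?thesis using wx wy pq by simp
qed

section \<open>Arithmetic of the field with 49 elements\<close>

locale field49 =
  fixes e :: "'a :: finite_field"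
  assumes card: "CARD('a) = 7 ^ 2" and e_root: "e ^ 2 + 6 * e + 3 = 0"
begin

lemma seven: "(7 :: 'a) = 0"
proof -
  have "of_nat (7 ^ 2) = (0 :: 'a)" using of_nat_card_eq_0[where 'a = 'a] by (simp only: card)
  hence "(7 :: 'a) ^ 2 = 0" by (simp only: of_nat_power of_nat_numeral)
  thus ?thesis by (simp only: power_eq_0_iff)
qed

lemma power_49: "x ^ 49 = (x :: 'a)"
  using finite_field_power_card_eq_same[of x] by (simp add: card)

lemma power_48: "x \<noteq> 0 \<Longrightarrow> x ^ 48 = (1 :: 'a)"
  using power_49[of x] by (simp add: power_Suc2[of x 48, simplified])

lemma two_nonzero: "(2 :: 'a) \<noteq> 0"
proof
  assume "(2 :: 'a) = 0"
  moreover have "(1 :: 'a) = 4 * 2 - 7" by simp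
  ultimately show False using seven by simp
qed

lemma three_nonzero: "(3 :: 'a) \<noteq> 0"
proof
  assume "(3 :: 'a) = 0"
  moreover have "(1 :: 'a) = 5 * 3 - 2 * 7" by simp
  ultimately show False using seven by simp
qed

lemma e_power2: "e ^ 2 = e + 4"
proof -
  have "e ^ 2 = e + 4 + (e ^ 2 + 6 * e + 3) - 7 * (e + 1)" by simp
  thus ?thesis by (simp only: e_root seven) simp
qed

text \<open>From this follow \<open>e ^ 16 = 2\<close> and \<open>e ^ 24 = -1\<close>, which later
  show that \<open>e\<close> generates the multiplicative group.\<close>

lemma e_power8: "e ^ 8 = 3"
proof -
  have "e ^ 4 = (e ^ 2) ^ 2" by simp
  also have "\<dots> = (e ^ 2 - (e + 4)) + 2 * e + 6 + 7 * (e + 2)"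
    unfolding e_power2 by (simp add: power2_sum e_power2)
  also have "\<dots> = 2 * e + 6" by (simp add: e_power2 seven)
  finally have e4: "e ^ 4 = 2 * e + 6" .
  have "e ^ 8 = (e ^ 4) ^ 2" by simp
  also have "\<dots> = 4 * (e ^ 2 - (e + 4)) + 3 + 7 * (4 * e + 7)"
    unfolding e4 by (simp add: power2_sum power_mult_distrib)
  finally show ?thesis by (simp add: e_power2 seven)
qed

lemma e_nonzero: "e \<noteq> 0"
  using e_power8 three_nonzero by (auto simp: zero_power)

lemma e_power16: "e ^ 16 = 2"
proof -
  have "e ^ 16 = (e ^ 8) ^ 2" by simp
  also have "\<dots> = 2 + 7" by (simp add: e_power8)
  finally show ?thesis by (simp only: seven) simp
qed

lemma e_power24: "e ^ 24 = -1"
proof -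
  have "e ^ 24 = e ^ 16 * e ^ 8" by (simp flip: power_add)
  also have "\<dots> = -1 + 7" by (simp add: e_power8 e_power16)
  finally show ?thesis by (simp only: seven) simp
qed

lemma add_power7_poly: "(x + y :: 'a poly) ^ 7 = x ^ 7 + y ^ 7"
  by (intro add_power_7 seven_poly seven)

lemma add_power49_poly: "(x + y :: 'a poly) ^ 49 = x ^ 49 + y ^ 49"
proof -
  have "z ^ 49 = (z ^ 7) ^ 7" for z :: "'a poly" by (simp flip: power_mult)
  thus ?thesis by (simp only: add_power7_poly)
qed

lemma coeff_mult_power7:
  "coeff (p * r ^ 7) n = (\<Sum>j\<le>n div 7. coeff p (n - 7 * j) * coeff (r :: 'a poly) j ^ 7)"
  by (rule coeff_mult_power_additive[OF add_power7_poly]) simp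

lemma coeff_mult_power49:
  "coeff (p * r ^ 49) n = (\<Sum>j\<le>n div 49. coeff p (n - 49 * j) * coeff (r :: 'a poly) j)"
  by (subst coeff_mult_power_additive[OF add_power49_poly]) (simp_all add: power_49)

lemma seven_ac: "(7 :: 'a alg_closure) = 0"
  using seven by (metis to_ac_0 to_ac_numeral)

text \<open>The condition on \<open>c\<close> says that it is not a \<open>k\<close>-th power in the
  base field. Modulo \<open>2304 = 48 ^ 2\<close> the order \<open>49 ^ (48 * l + 1)\<close> is 49.
  Hence \<open>z ^ k = c\<close> would turn \<open>z ^ (49 ^ (48 * l + 1)) = z\<close> into
  \<open>c ^ (48 div k * (48 * N + 1)) = 1\<close>, which \<open>c ^ 48 = 1\<close> reduces to
  \<open>c ^ (48 div k) = 1\<close>.\<close>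

lemma power_ext_field_neq:
  assumes k: "k dvd 48" and c: "c \<noteq> 0" "c ^ (48 div k) \<noteq> 1"
    and z: "z \<in> ext_field (48 * l + 1)"
  shows "z ^ k \<noteq> to_ac (c :: 'a)"
proof
  assume zk: "z ^ k = to_ac c"
  have k0: "k > 0" using k by (auto intro: Nat.gr0I)
  hence z0: "z \<noteq> 0" using zk c by (auto simp: zero_power)
  have "49 ^ (48 * l) mod (2304 :: nat) = (49 ^ 48 mod 2304) ^ l mod 2304"
    by (simp only: power_mult power_mod)
  also have "(49 ^ 48 mod 2304 :: nat) = 1" by simp
  finally have "49 ^ (48 * l + 1) mod (2304 :: nat) = 49"
    by (simp add: mod_mult_right_eq[symmetric, of 49])
  then obtain N where N: "49 ^ (48 * l + 1) = 49 + 2304 * (N :: nat)"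
    by (metis mod_mult_div_eq add.commute mult.commute)
  have "to_ac c ^ (48 div k * (48 * N + 1)) * z = z ^ (k * (48 div k) * (48 * N + 1)) * z"
    by (simp only: zk[symmetric] power_mult)
  also have "\<dots> = z ^ (49 + 2304 * N)"
  proof -
    have "k * (48 div k) * (48 * N + 1) + 1 = 49 + 2304 * N" using k by simp
    thus ?thesis by (metis power_add power_one_right)
  qed
  also have "\<dots> = z" using z by (simp add: ext_field_def card N[symmetric])
  finally have "to_ac (c ^ (48 div k * (48 * N + 1))) = 1" using z0 by simp
  hence "c ^ (48 div k * (48 * N + 1)) = 1" by (simp only: to_ac_eq_1_iff)
  moreover have "c ^ (48 div k * (48 * N + 1)) = (c ^ 48) ^ (48 div k * N) * c ^ (48 div k)"
    by (simp add: algebra_simps flip: power_mult power_add)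
  ultimately show False using c power_48[of c] by simp
qed

text \<open>In every extension of degree \<open>48 * l + 1\<close> the element \<open>-b\<close> is
  still not a \<open>k\<close>-th power. All elements whose \<open>k\<close>-th powers
  \<open>mult_power_eq_imp_eq\<close> compares with \<open>-b\<close> lie in that extension, so the
  map is injective there.\<close>

lemma exceptional_mult_power:
  assumes kr: "k * r = 6" and b: "b \<noteq> 0" "(- b) ^ (48 div k) \<noteq> (1 :: 'a)"
  shows "exceptional (monom 1 1 * (monom 1 k + [:b:]) ^ r)"
proof -
  define g where "g = monom 1 1 * (monom 1 k + [:b:]) ^ r"
  have k: "k dvd 48"
  proof -
    have "k dvd 6" using kr by (metis dvd_triv_left)
    thus ?thesis by (rule dvd_trans) simp
  qed
  have g: "poly (map_poly to_ac g) x = x * (x ^ k + to_ac b) ^ r" for x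
    by (simp add: g_def map_poly_to_ac_mult map_poly_to_ac_power map_poly_to_ac_add
        map_poly_monom map_poly_pCons poly_monom)
  have pp: "permutation_polynomial_ext (48 * l + 1) g" for l
  proof -
    define K :: "'a alg_closure set" where "K = ext_field (48 * l + 1)"
    have power: "x ^ n \<in> K" if "x \<in> K" for x n
      using that unfolding K_def by (induction n) (auto intro: ext_field_1 ext_field_mult)
    have nk: "x ^ k \<noteq> - to_ac b" if "x \<in> K" for x
      using power_ext_field_neq[of k "- b" x l] that k b by (simp add: K_def)
    have val: "x * (x ^ k + to_ac b) ^ r \<in> K" if "x \<in> K" for x
      using that power unfolding K_def
      by (metis ext_field_mult ext_field_add to_ac_in_ext_field)
    have fin: "finite K"
      using card_ext_field[of "48 * l + 1", where 'a = 'a] card_gt_1[where 'a = 'a]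
      unfolding K_def by (intro card_ge_0_finite) simp
    have "inj_on (poly (map_poly to_ac g)) K"
    proof (rule inj_onI)
      fix x y assume x: "x \<in> K" and y: "y \<in> K"
        and eq: "poly (map_poly to_ac g) x = poly (map_poly to_ac g) y"
      have inv: "inverse (u ^ k + to_ac b) \<in> K" if "u \<in> K" for u
        using that power unfolding K_def
        by (metis ext_field_inverse ext_field_add to_ac_in_ext_field)
      have "inverse (x ^ k + to_ac b) - inverse (y ^ k + to_ac b) \<in> K"
        using inv[OF x] inv[OF y] unfolding K_def
        by (metis ext_field_uminus ext_field_add diff_conv_add_uminus)
      hence "x * (x ^ k + to_ac b) ^ r *
          (inverse (x ^ k + to_ac b) - inverse (y ^ k + to_ac b)) ^ i \<in> K" for i
        using val[OF x] power by (auto simp: K_def intro: ext_field_mult)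
      thus "x = y"
        using eq nk x y by (intro mult_power_eq_imp_eq[OF seven_ac kr, of x "to_ac b" y]) (auto simp: g)
    qed
    moreover have "poly (map_poly to_ac g) ` K \<subseteq> K" using val by (auto simp: g)
    ultimately have "bij_betw (poly (map_poly to_ac g)) K K"
      using fin by (simp add: bij_betw_def endo_inj_surj)
    thus ?thesis by (simp add: permutation_polynomial_ext_def K_def)
  qed
  have "range (\<lambda>l. 48 * l + 1) \<subseteq> {m. m > 0 \<and> permutation_polynomial_ext m g}"
    using pp by auto
  moreover have "infinite (range (\<lambda>l. 48 * l + 1 :: nat))"
    by (intro range_inj_infinite) (auto intro: injI)
  ultimately show ?thesis unfolding exceptional_def g_def by (rule infinite_super)
qed

section \<open>The non-exceptional permutation polynomial\<close>

text \<open>The index is \<open>s * (Q - 1)\<close> for \<open>Q = 49 * M\<close>. Written as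
  \<open>49 * (s * M) - s\<close>, it pairs the coefficient of \<open>q\<close> at
  \<open>s * M - i\<close> with that of \<open>p\<close> at \<open>49 * i - s\<close>. Here
  \<open>i \<ge> 1\<close> since \<open>s > 0\<close>, and the degree bound on \<open>p\<close>
  gives \<open>i \<le> 3\<close>.\<close>

lemma coeff_mult_power49_shift:
  assumes s: "0 < s" "s < 49" and M: "M > 0" and p: "degree p < 196 - s"
  shows "coeff (p * q ^ 49) (s * (49 * M) - s) =
    (\<Sum>i\<in>{1, 2, 3} \<inter> {..s * M}. coeff p (49 * i - s) * coeff (q :: 'a poly) (s * M - i))"
proof -
  define L where "L = s * M"
  have L: "L > 0" "s \<le> L" using s M by (auto simp: L_def)
  have n: "s * (49 * M) - s = 49 * L - s" by (simp add: L_def)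
  have dv: "(49 * L - s) div 49 = L - 1"
    using L s by (intro div_nat_eqI) auto
  have "coeff (p * q ^ 49) (49 * L - s) = (\<Sum>j\<le>L - 1. coeff p (49 * L - s - 49 * j) * coeff q j)"
    unfolding coeff_mult_power49 dv ..
  also have "\<dots> = (\<Sum>i\<in>{1..L}. coeff p (49 * i - s) * coeff q (L - i))"
  proof (rule sum.reindex_bij_witness[of _ "\<lambda>i. L - i" "\<lambda>j. L - j"])
    fix j assume "j \<in> {..L - 1}"
    hence "49 * (L - j) - s = 49 * L - s - 49 * j" "L - (L - j) = j" using L by auto
    thus "coeff p (49 * (L - j) - s) * coeff q (L - (L - j)) =
        coeff p (49 * L - s - 49 * j) * coeff q j" by simp
  qed (use L in auto)
  also have "\<dots> = (\<Sum>i\<in>{1, 2, 3} \<inter> {..L}. coeff p (49 * i - s) * coeff q (L - i))"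
  proof (rule sum.mono_neutral_right)
    show "\<forall>i\<in>{1..L} - {1, 2, 3} \<inter> {..L}. coeff p (49 * i - s) * coeff q (L - i) = 0"
    proof
      fix i assume "i \<in> {1..L} - {1, 2, 3} \<inter> {..L}"
      hence "i \<ge> 4" by auto
      hence "degree p < 49 * i - s" using p by linarith
      thus "coeff p (49 * i - s) * coeff q (L - i) = 0" by (simp add: coeff_eq_0)
    qed
  qed auto
  finally show ?thesis by (simp only: n L_def)
qed

text \<open>This is \<open>x^7 + e x^5 + e^18 x^3 + e^35 x\<close>, because
  \<open>e ^ 16 = 2\<close> gives \<open>e ^ 18 = 2 * e ^ 2\<close> and
  \<open>e ^ 35 = 4 * e ^ 3\<close>.\<close>

definition special :: "'a poly" where
  "special = normal_form e 0 (2 * e ^ 2) 0 (4 * e ^ 3)"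

lemma degree_special [simp]: "degree special = 7"
  by (simp add: special_def)

text \<open>\<open>m + 3\<close> and \<open>r\<close> are the quotient and remainder of the index
  modulo 7. As \<open>degree p \<le> 21\<close>, only four coefficients of \<open>q\<close> can
  contribute.\<close>

lemma coeff_mult_power7_digits:
  assumes "degree p \<le> 21" "r < 7"
  shows "coeff (p * q ^ 7) (7 * (m + 3) + r) =
    coeff p (r + 21) * coeff (q :: 'a poly) m ^ 7 + coeff p (r + 14) * coeff q (m + 1) ^ 7 +
    coeff p (r + 7) * coeff q (m + 2) ^ 7 + coeff p r * coeff q (m + 3) ^ 7"
proof -
  have "coeff (p * q ^ 7) (7 * (m + 3) + r) =
      (\<Sum>j\<le>m + 3. coeff p (7 * (m + 3) + r - 7 * j) * coeff q j ^ 7)"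
  proof -
    have "(7 * (m + 3) + r) div 7 = m + 3" using assms by (intro div_nat_eqI) auto
    thus ?thesis unfolding coeff_mult_power7 by (simp only:)
  qed
  also have "\<dots> = (\<Sum>j\<in>{m, m + 1, m + 2, m + 3}. coeff p (7 * (m + 3) + r - 7 * j) * coeff q j ^ 7)"
    using assms by (intro sum.mono_neutral_right) (auto intro!: coeff_eq_0)
  finally show ?thesis by (simp add: algebra_simps)
qed

text \<open>The indices are \<open>49 * i - 2\<close> for \<open>i = 1, 2\<close>; for
  \<open>i = 3\<close> the index exceeds the degree 112. The exponent is split as
  \<open>16 = 2 + 7 * 2\<close>.\<close>

lemma special_power16: "coeff (special ^ 16) 47 = 0" "coeff (special ^ 16) 96 \<noteq> 0"
proof -
  have *: "special ^ 16 = special ^ 2 * (special ^ 2) ^ 7" by (simp flip: power_mult power_add)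
  have c: "coeff (special ^ 2) 4 = 16 * e ^ 5" "coeff (special ^ 2) 5 = 0" "coeff (special ^ 2) 11 = 0"
    "coeff (special ^ 2) 13 = 0" "coeff (special ^ 2) 12 = 2 * e"
    unfolding special_def normal_form_power2 by (simp_all add: eval_nat_numeral)
  have big: "coeff (special ^ 2) n = 0" if "n > 14" for n
    using that by (intro coeff_eq_0) (simp add: degree_power_eq special_def normal_form_def)
  have deg: "degree (special ^ 2) \<le> 21"
    using degree_power_le[of special 2] by simp
  show "coeff (special ^ 16) 47 = 0"
    unfolding * using coeff_mult_power7_digits[OF deg, of 5 "special ^ 2" 3] by (simp add: c big)
  show "coeff (special ^ 16) 96 \<noteq> 0"
    unfolding * using coeff_mult_power7_digits[OF deg, of 5 "special ^ 2" 10]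
      power_not_zero[OF two_nonzero, of 8] by (simp add: c big e_nonzero)
qed

text \<open>The indices are \<open>49 * i - 2\<close> and \<open>49 * i - 1\<close> for
  \<open>i = 1, 2, 3\<close>, and only \<open>96 = 49 * 2 - 2\<close> carries a nonzero coefficient.
  The exponent is split as \<open>24 = 3 + 7 * 3\<close>.\<close>

lemma special_power24:
  "coeff (special ^ 24) 47 = 0" "coeff (special ^ 24) 48 = 0" "coeff (special ^ 24) 96 \<noteq> 0"
  "coeff (special ^ 24) 97 = 0" "coeff (special ^ 24) 145 = 0" "coeff (special ^ 24) 146 = 0"
proof -
  have *: "special ^ 24 = special ^ 3 * (special ^ 3) ^ 7" by (simp flip: power_mult power_add)
  have "coeff (special ^ 3) 13 = 7 * (6 * e ^ 4)"
    unfolding special_def normal_form_power3 by (simp add: eval_nat_numeral)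
  hence c13: "coeff (special ^ 3) 13 = 0" by (simp only: seven mult_zero_left)
  have "coeff (special ^ 3) 11 = 2 * e ^ 5 + 7 * (10 * e ^ 5)"
    unfolding special_def normal_form_power3 by (simp add: eval_nat_numeral)
  hence c11: "coeff (special ^ 3) 11 = 2 * e ^ 5"
    by (simp only: seven mult_zero_left add_0_right)
  have c: "coeff (special ^ 3) 4 = 0" "coeff (special ^ 3) 6 = 0" "coeff (special ^ 3) 12 = 0"
    "coeff (special ^ 3) 18 = 0" "coeff (special ^ 3) 20 = 0" "coeff (special ^ 3) 19 = 3 * e"
    unfolding special_def normal_form_power3 by (simp_all add: eval_nat_numeral)
  have big: "coeff (special ^ 3) n = 0" if "n > 21" for n
    using that by (intro coeff_eq_0) (simp add: degree_power_eq special_def normal_form_def)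
  have deg: "degree (special ^ 3) \<le> 21"
    using degree_power_le[of special 3] by simp
  note digits = coeff_mult_power7_digits[OF deg, of _ "special ^ 3"]
  show "coeff (special ^ 24) 47 = 0" "coeff (special ^ 24) 48 = 0"
    unfolding * using digits[of 5 3] digits[of 6 3] by (simp_all add: c c13 big)
  show "coeff (special ^ 24) 96 \<noteq> 0" "coeff (special ^ 24) 97 = 0"
    unfolding * using digits[of 5 10] digits[of 6 10]
      no_zero_divisors[OF three_nonzero power_not_zero[OF two_nonzero, of 7]]
    by (simp_all add: c c11 c13 big e_nonzero)
  show "coeff (special ^ 24) 145 = 0" "coeff (special ^ 24) 146 = 0"
    unfolding * using digits[of 5 17] digits[of 6 17] by (simp_all add: c c13 big)
qed

text \<open>All \<open>t\<close> digits of \<open>r\<close> in base 49 are 16. Splitting off the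
  factor \<open>special ^ 16\<close> of the lowest digit leaves only the term \<open>i = 2\<close>,
  which leads to the index \<open>2 * 49 ^ t - 2\<close> of the same form for the remaining
  digits.\<close>

lemma special_power_repunit:
  assumes "3 * r + 1 = 49 ^ t"
  shows "coeff (special ^ r) (2 * 49 ^ t - 2) \<noteq> 0"
  using assms
proof (induction t arbitrary: r)
  case 0
  thus ?case by simp
next
  case (Suc t)
  obtain r' where r': "3 * r' + 1 = (49 :: nat) ^ t"
  proof -
    have "(49 :: nat) ^ t mod 3 = 1" by (subst power_mod[symmetric]) simp
    thus ?thesis using that[of "49 ^ t div 3"] by (metis mult_div_mod_eq)
  qed
  have r: "r = 16 + r' * 49" using Suc.prems r' by simp
  have deg: "degree (special ^ 16) < 196 - 2"
    using degree_power_le[of special 16] by simp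
  have t: "2 \<le> 2 * (49 :: nat) ^ t" by simp
  have c3: "coeff (special ^ 16) (49 * 3 - 2) = 0"
    by (rule coeff_eq_0) (use degree_power_le[of special 16] in simp)
  have "coeff (special ^ r) (2 * 49 ^ Suc t - 2) =
      (\<Sum>i\<in>{1, 2, 3} \<inter> {..2 * 49 ^ t}.
        coeff (special ^ 16) (49 * i - 2) * coeff (special ^ r') (2 * 49 ^ t - i))"
    using coeff_mult_power49_shift[OF _ _ _ deg, of "49 ^ t" "special ^ r'"]
    by (simp add: r power_add power_mult)
  also have "\<dots> = (\<Sum>i\<in>{2}.
        coeff (special ^ 16) (49 * i - 2) * coeff (special ^ r') (2 * 49 ^ t - i))"
    using t special_power16(1) c3
    by (intro sum.mono_neutral_right) auto
  finally show ?case using Suc.IH[OF r'] special_power16(2) by simp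
qed

text \<open>The exponent \<open>k\<close> has lowest base 49 digit 24 and all others 16. The factor
  \<open>special ^ 24\<close> makes the coefficient at \<open>Q - 1\<close> vanish, whereas the one
  at \<open>2 * (Q - 1)\<close> is a nonzero multiple of the coefficient of
  \<open>special ^ r\<close> at \<open>2 * M - 2\<close>, which is nonzero. This contradicts
  Hermite's criterion.\<close>

lemma not_permutation_polynomial_ext_special:
  assumes "m \<ge> 2"
  shows "\<not> permutation_polynomial_ext m special"
proof
  assume pp: "permutation_polynomial_ext m special"
  define M :: nat where "M = 49 ^ (m - 1)"
  obtain t where t: "m = Suc (Suc t)" using assms by (metis add_2_eq_Suc le_Suc_ex)
  have Q: "CARD('a) ^ m = 49 * M" by (simp add: card M_def t)
  have M: "M \<ge> 49" by (simp add: M_def t)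
  obtain r where r: "3 * r + 1 = M"
  proof -
    have "M mod 3 = 1" unfolding M_def by (subst power_mod[symmetric]) simp
    thus ?thesis using that[of "M div 3"] by (metis mult_div_mod_eq)
  qed
  define k where "k = 24 + r * 49"
  have deg: "degree (special ^ 24) < 196 - s" if "s \<le> 2" for s
    using degree_power_le[of special 24] that by simp
  have split: "special ^ k = special ^ 24 * (special ^ r) ^ 49"
    by (simp add: k_def power_add power_mult)
  have m: "m > 0" using assms by simp
  have M3: "{1, 2, 3} \<inter> {..1 * M} = {1, 2, 3}" "{1, 2, 3} \<inter> {..2 * M} = {1, 2, 3}" using M by auto
  have "coeff (special ^ k) (49 * M - 1) = 0"
    using coeff_mult_power49_shift[OF _ _ _ deg, of 1 M "special ^ r", unfolded M3] M
    by (simp add: split special_power24)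
  moreover have "coeff (special ^ k) (2 * (49 * M - 1)) \<noteq> 0"
    using coeff_mult_power49_shift[OF _ _ _ deg, of 2 M "special ^ r", unfolded M3] M
      special_power_repunit[of r "m - 1"] r
    by (simp add: split special_power24 diff_mult_distrib2 M_def)
  moreover have "coeff (special ^ k) (49 * M - 1) + coeff (special ^ k) (2 * (49 * M - 1)) = 0"
    using hermite[OF m pp, of k] r M by (simp add: Q k_def)
  ultimately show False by simp
qed

lemma not_exceptional_special: "\<not> exceptional special"
proof -
  have "{m. m > 0 \<and> permutation_polynomial_ext m special} \<subseteq> {..1}"
  proof
    fix m assume "m \<in> {m. m > 0 \<and> permutation_polynomial_ext m special}"
    hence "\<not> m \<ge> 2" using not_permutation_polynomial_ext_special by blast
    thus "m \<in> {..1}" by simp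
  qed
  thus ?thesis unfolding exceptional_def by (meson finite_atMost finite_subset)
qed

section \<open>Classification\<close>

text \<open>
  Consequences of \<open>7 = 0\<close> are derived below from integral identities of the form
  \<open>E = E' + 7 * R\<close> with an explicit \<open>R\<close>, as the Groebner basis method knows nothing about the
  characteristic.
\<close>

lemma hermite49:
  fixes f :: "'a poly"
  assumes pp: "permutation_polynomial_ext 1 f" and f: "degree f = 7" and j: "j \<le> 5"
  shows "(\<Sum>i\<le>6. coeff (f ^ j) (48 - 7 * i) * coeff f i ^ 7) = 0"
proof -
  \<comment> \<open>The exponent \<open>j + 7 \<le> 12\<close> keeps the degree at most 84, so only
    the coefficient at 48 remains, and it is read off from \<open>f ^ j * f ^ 7\<close>.\<close>
  have "degree (f ^ (j + 7)) < 96"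
    using degree_power_le[of f "j + 7"] f j by simp
  hence "coeff (f ^ (j + 7)) 96 = 0" by (rule coeff_eq_0)
  moreover have "coeff (f ^ (j + 7)) 48 + coeff (f ^ (j + 7)) 96 = 0"
    using hermite[of 1 f "j + 7"] pp f j by (simp add: card)
  ultimately show ?thesis by (simp add: power_add coeff_mult_power7)
qed

text \<open>The terms \<open>i = 0\<close> and \<open>i = 6\<close> drop out with the coefficients
  of \<open>f\<close>, and \<open>i = 1\<close> because the index 41 exceeds the degree of
  \<open>f ^ j\<close>.\<close>

lemma hermite49_normal_form:
  fixes a\<^sub>5 a\<^sub>4 a\<^sub>3 a\<^sub>2 a\<^sub>1 :: 'a
  assumes f: "f = normal_form a\<^sub>5 a\<^sub>4 a\<^sub>3 a\<^sub>2 a\<^sub>1"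
    and pp: "permutation_polynomial_ext 1 f" and j: "j \<le> 5"
  shows "coeff (f ^ j) 34 * a\<^sub>2 ^ 7 + coeff (f ^ j) 27 * a\<^sub>3 ^ 7 + coeff (f ^ j) 20 * a\<^sub>4 ^ 7
    + coeff (f ^ j) 13 * a\<^sub>5 ^ 7 = 0"
proof -
  have deg: "degree f = 7" by (simp add: f)
  have "coeff (f ^ j) 41 = 0"
    by (rule coeff_eq_0) (use degree_power_le[of f j] deg j in simp)
  moreover have "coeff f 0 = 0" "coeff f 1 = a\<^sub>1" "coeff f 2 = a\<^sub>2" "coeff f 3 = a\<^sub>3" "coeff f 4 = a\<^sub>4"
    "coeff f 5 = a\<^sub>5" "coeff f 6 = 0"
    by (simp_all add: f normal_form_def coeff_pCons_numeral)
  moreover have "{..6} = {0, 1, 2, 3, 4, 5, 6 :: nat}" by auto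
  ultimately show ?thesis using hermite49[OF pp deg j] by (simp add: algebra_simps)
qed

text \<open>
  For a root \<open>b\<close> of the quintic \<open>Q\<close>, reducing \<open>b^7\<close> modulo \<open>Q\<close> twice writes \<open>b = b^49\<close> as a
  polynomial of degree \<open>4\<close> in \<open>b\<close>, and that equation is coprime to \<open>Q\<close>.
\<close>
lemma quintic_no_root: "6*b^5 + 6*b^4 + b^3 + 5*b^2 + b + 3 \<noteq> (0 :: 'a)"
proof
  define Q where "Q = 6*b^5 + 6*b^4 + b^3 + 5*b^2 + b + (3 :: 'a)"
  assume "6*b^5 + 6*b^4 + b^3 + 5*b^2 + b + 3 = (0 :: 'a)"
  hence Q: "Q = 0" by (simp add: Q_def)
  define s where "s = 6 + 6*b + 5*b^2 + 5*b^3 + 2*b^4"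
  note zero = Q seven mult_zero_left mult_zero_right add_0_right
  have "b^7 = s + (5 + b + 6*b^2) * Q
      + 7 * (-3 - 2*b - 7*b^2 - 3*b^3 - 9*b^4 - 6*b^5 - 6*b^6 - 5*b^7)"
    unfolding s_def Q_def by Groebner_Basis.algebra
  hence s: "b ^ 7 = s" by (simp only: zero)
  have "s^2 = 1 + 3*b + 2*b^2 + 5*b^3 + 2*b^4 + (2*b + 5*b^2 + 3*b^3) * Q
      + 7 * (5 + 9*b + 11*b^2 + 13*b^3 + 11*b^4 + 6*b^5 - 4*b^7 - 2*b^8)"
    unfolding s_def Q_def by Groebner_Basis.algebra
  hence s2: "s^2 = 1 + 3*b + 2*b^2 + 5*b^3 + 2*b^4" by (simp only: zero)
  have "(1 + 3*b + 2*b^2 + 5*b^3 + 2*b^4) * s = 3 + 6*b + 6*b^4 + (1 + b + 5*b^2 + 3*b^3) * Q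
      + 7 * (2*b + 2*b^2 + 6*b^3 + 4*b^4 + 3*b^5 - 4*b^7 - 2*b^8)"
    unfolding s_def Q_def by Groebner_Basis.algebra
  hence s3: "s^2 * s = 3 + 6*b + 6*b^4" unfolding s2 by (simp only: zero)
  have "(1 + 3*b + 2*b^2 + 5*b^3 + 2*b^4)^2 = 2 + 4*b + 2*b^2 + 6*b^3 + 5*b^4
      + (2 + 5*b^2 + 3*b^3) * Q + 7 * (-1 - 2*b^2 - b^4 - 4*b^7 - 2*b^8)"
    unfolding Q_def by Groebner_Basis.algebra
  hence s4: "(s^2)^2 = 2 + 4*b + 2*b^2 + 6*b^3 + 5*b^4" unfolding s2 by (simp only: zero)
  have n: "(2 :: 'a) ^ 7 = 2 + 7 * 18" "(5 :: 'a) ^ 7 = 5 + 7 * 11160" "(6 :: 'a) ^ 7 = 6 + 7 * 39990"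
    by simp_all
  hence n: "(2 :: 'a) ^ 7 = 2" "(5 :: 'a) ^ 7 = 5" "(6 :: 'a) ^ 7 = 6" by (simp_all only: zero)
  \<comment> \<open>The seventh power fixes the coefficients of \<open>s\<close> and replaces each
    \<open>b^i\<close> by \<open>s^i\<close>.\<close>
  have "b = s ^ 7" using power_49[of b] by (simp flip: s power_mult)
  also have "\<dots> = 6 + 6 * b^7 + 5 * (b^2)^7 + 5 * (b^3)^7 + 2 * (b^4)^7"
    unfolding s_def by (simp only: add_power_7[OF seven] power_mult_distrib n)
  also have "\<dots> = 6 + 6 * b^7 + 5 * (b^7)^2 + 5 * ((b^7)^2 * b^7) + 2 * ((b^7)^2)^2"
    by (simp flip: power_mult power_add)
  also have "\<dots> = 3 + 5*b + 2*b^2 + 4*b^3 + 6*b^4 + 7 * (9 + 12*b + 6*b^2 + 9*b^3 + 8*b^4)"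
    unfolding s unfolding s4 s3 unfolding s2 unfolding s_def by Groebner_Basis.algebra
  also have "\<dots> = 3 + 5*b + 2*b^2 + 4*b^3 + 6*b^4" by (simp only: zero)
  finally have b: "3 + 5*b + 2*b^2 + 4*b^3 + 6*b^4 - b = 0" by simp
  \<comment> \<open>A Bezout identity modulo 7 certifies the coprimality.\<close>
  have "(3 + b + 6*b^3 + 6*b^4) * (3 + 5*b + 2*b^2 + 4*b^3 + 6*b^4 - b) + (2 + 6*b + 3*b^2 + b^3) * Q
    = 1 + 7 * (2 + 5*b + 5*b^2 + 10*b^3 + 14*b^4 + 14*b^5 + 13*b^6 + 12*b^7 + 6*b^8)"
    unfolding Q_def by Groebner_Basis.algebra
  thus False unfolding b by (simp only: zero) simp
qed

text \<open>Measuring the coefficients in powers of \<open>a\<close> makes the conditions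
  homogeneous. If \<open>c \<noteq> 0\<close>, exponent 11 gives
  \<open>c^2 = 3 * b * (b - 5)^2 * a^5\<close>, so \<open>b\<close> is neither 0 nor 5. Inserted
  into the condition for exponent 12, this leaves only the quintic factor without roots.\<close>

lemma normal_form_a5_a2_eq_0:
  fixes a b c :: 'a
  assumes pp: "permutation_polynomial_ext 1 (normal_form a 0 (b * a^2) c ((3*b^2 + 3*b) * a^3))"
    and a: "a \<noteq> 0"
  shows "c = 0"
proof (rule ccontr)
  assume c: "c \<noteq> 0"
  define d where "d = 3*b^2 + 3*b"
  define g where "g = 3*b^3 + 5*b^2 + 5*b"
  \<comment> \<open>This is the condition for exponent 11 divided by \<open>c * a^7\<close>; modulo
    7, \<open>C = 0\<close> says \<open>c^2 = g * a^5\<close>.\<close>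
  define C where "C = 24*b*d*a^5 + 4*c^2 + 12*d*a^5 + 12*b^2*a^5"
  note zero = seven mult_zero_left mult_zero_right add_0_right
  have "coeff (normal_form a 0 (b * a^2) c (d * a^3) ^ 4) 34 = 0"
    using degree_power_le[of "normal_form a 0 (b * a^2) c (d * a^3)" 4]
    by (intro coeff_eq_0) simp
  hence "(24 * (b*a^2) * c * (d*a^3) + 4 * c^3 + 12 * a^2 * c * (d*a^3) + 12 * a * (b*a^2)^2 * c) * a^7 = 0"
    using hermite49_normal_form[OF refl pp, of 4, unfolded coeff_normal_form_power4, folded d_def]
    by simp
  also have "(24 * (b*a^2) * c * (d*a^3) + 4 * c^3 + 12 * a^2 * c * (d*a^3) + 12 * a * (b*a^2)^2 * c) * a^7
      = C * (c * a^7)"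
    unfolding C_def by Groebner_Basis.algebra
  finally have "C * (c * a^7) = 0" .
  hence C: "C = 0" using a c by simp
  have "c^2 = g * a^5 + 2 * C - 7 * c^2 + 7 * (-((11*b + 35*b^2 + 21*b^3) * a^5))"
    unfolding C_def d_def g_def by Groebner_Basis.algebra
  hence c2: "c^2 = g * a^5" by (simp add: C seven)
  have "g = 3 * b * (b - 5)^2 + 7 * (5*b^2 - 10*b)"
    unfolding g_def by Groebner_Basis.algebra
  hence "g = 3 * b * (b - 5)^2" by (simp only: zero)
  hence nz: "b \<noteq> 0" "b - 5 \<noteq> 0" using c2 c by auto
  \<comment> \<open>The condition for exponent 12, divided by \<open>a^18\<close> after eliminating
    \<open>c\<close>.\<close>
  define E where "E = 20*b*d^3 + 10*d^3 + 30*b^2*d^2 + 5*b^4*d + g*(30*d^2 + 60*b*d + 10*b^3)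
    + 5*g^2 + b^7 * (20*d + 10*b^2 + 30*b + 5)"
  have c4: "c^4 = (g * a^5)^2" by (simp flip: c2)
  have "(20 * a * (d*a^3) + 10 * (b*a^2)^2 + 30 * a^2 * (b*a^2) + 5 * a^4) * (b*a^2)^7
      + (20 * (b*a^2) * (d*a^3)^3 + 10 * a^2 * (d*a^3)^3 + 30 * a * (b*a^2)^2 * (d*a^3)^2
      + 5 * (b*a^2)^4 * (d*a^3) + c^2 * (30 * (d*a^3)^2 + 60 * a * (b*a^2) * (d*a^3) + 10 * (b*a^2)^3)
      + 5 * a * c^4) * a^7 = 0"
    using hermite49_normal_form[OF refl pp, of 5, unfolded coeff_normal_form_power5, folded d_def]
    by simp
  also have "(20 * a * (d*a^3) + 10 * (b*a^2)^2 + 30 * a^2 * (b*a^2) + 5 * a^4) * (b*a^2)^7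
      + (20 * (b*a^2) * (d*a^3)^3 + 10 * a^2 * (d*a^3)^3 + 30 * a * (b*a^2)^2 * (d*a^3)^2
      + 5 * (b*a^2)^4 * (d*a^3) + c^2 * (30 * (d*a^3)^2 + 60 * a * (b*a^2) * (d*a^3) + 10 * (b*a^2)^3)
      + 5 * a * c^4) * a^7 = E * a^18"
    unfolding E_def c2 c4 by Groebner_Basis.algebra
  finally have "E * a^18 = 0" .
  hence "E = 0" using a by simp
  moreover have "E = b^2 * (b - 5) * (6*b^5 + 6*b^4 + b^3 + 5*b^2 + b + 3)
      + 7 * (20*b^2 + 396*b^3 + 1117*b^4 + 1355*b^5 + 827*b^6 + 197*b^7 + 12*b^8 + 10*b^9)"
    unfolding E_def d_def g_def by Groebner_Basis.algebra
  ultimately have "b^2 * (b - 5) * (6*b^5 + 6*b^4 + b^3 + 5*b^2 + b + 3) = 0" by (simp only: zero)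
  thus False using nz quintic_no_root[of b] by simp
qed

text \<open>Exponent 12 restricts \<open>b\<close> to the roots of an explicit polynomial, and
  exponent 16 gives \<open>a^24 * b^8 = 3\<close>. Since \<open>a^24\<close> is 1 or -1,
  \<open>b^8\<close> must be 3 or -3. This excludes \<open>b = 0\<close>, \<open>b = 4\<close> with
  \<open>b^8 = 2\<close>, and the quadratic factor with \<open>b^8 = 5\<close>; both 2 and 5 have
  \<open>b^8 = 4 = -3\<close>, whence \<open>a^24 = -1\<close>.\<close>

lemma normal_form_a5_a2_zero:
  fixes a b :: 'a
  assumes pp: "permutation_polynomial_ext 1 (normal_form a 0 (b * a^2) 0 ((3*b^2 + 3*b) * a^3))"
    and a: "a \<noteq> 0"
  shows "a^24 = -1" "b = 2 \<or> b = 5"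
proof -
  define d where "d = 3*b^2 + 3*b"
  define f where "f = normal_form a 0 (b * a^2) 0 (d * a^3)"
  note zero = seven mult_zero_left mult_zero_right add_0_right
  define E where "E = 20*b*d^3 + 10*d^3 + 30*b^2*d^2 + 5*b^4*d
    + b^7 * (20*d + 10*b^2 + 30*b + 5)"
  have "(20 * a * (d*a^3) + 10 * (b*a^2)^2 + 30 * a^2 * (b*a^2) + 5 * a^4) * (b*a^2)^7
      + (20 * (b*a^2) * (d*a^3)^3 + 10 * a^2 * (d*a^3)^3 + 30 * a * (b*a^2)^2 * (d*a^3)^2
      + 5 * (b*a^2)^4 * (d*a^3)) * a^7 = 0"
    using hermite49_normal_form[OF refl pp, of 5, unfolded coeff_normal_form_power5, folded d_def]
    by simp
  also have "(20 * a * (d*a^3) + 10 * (b*a^2)^2 + 30 * a^2 * (b*a^2) + 5 * a^4) * (b*a^2)^7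
      + (20 * (b*a^2) * (d*a^3)^3 + 10 * a^2 * (d*a^3)^3 + 30 * a * (b*a^2)^2 * (d*a^3)^2
      + 5 * (b*a^2)^4 * (d*a^3)) * a^7 = E * a^18"
    unfolding E_def by Groebner_Basis.algebra
  finally have "E * a^18 = 0" .
  hence "E = 0" using a by simp
  moreover have "E = b^3 * (b - 2) * (b - 4) * (b - 5) * (6*b^2 + 2*b + 2)
      + 7 * (50*b^3 + 232*b^4 + 453*b^5 + 281*b^6 + 87*b^7 + 12*b^8 + 10*b^9)"
    unfolding E_def d_def by Groebner_Basis.algebra
  ultimately have factors: "b^3 * (b - 2) * (b - 4) * (b - 5) * (6*b^2 + 2*b + 2) = 0"
    by (simp only: zero)
  have norm: "a^24 * b^8 = 3"
  proof -
    \<comment> \<open>The degree 112 of \<open>f ^ 16\<close> exceeds 96, so both coefficients of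
      Hermite's criterion enter.\<close>
    have *: "f ^ 16 = f ^ 2 * (f ^ 2) ^ 7" by (simp flip: power_mult power_add)
    have deg: "degree (f ^ 2) \<le> 21"
      using degree_power_le[of f 2] by (simp add: f_def)
    have big: "coeff (f ^ 2) n = 0" if "n > 14" for n
      by (rule coeff_eq_0) (use that degree_power_le[of f 2] in \<open>simp add: f_def\<close>)
    have c: "coeff (f ^ 2) 6 = 2*a*(d*a^3) + (b*a^2)^2" "coeff (f ^ 2) 12 = 2 * a"
      "coeff (f ^ 2) 13 = 0" "coeff (f ^ 2) 5 = 0"
      unfolding f_def normal_form_power2 by (simp_all add: coeff_pCons_numeral)
    have "2*a*(d*a^3) + (b*a^2)^2 = - (a^4*b) + 7 * (a^4*(b^2 + b))"
      unfolding d_def by Groebner_Basis.algebra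
    hence c6: "coeff (f ^ 2) 6 = - (a^4*b)" unfolding c by (simp only: zero)
    have "coeff (f ^ 16) 48 = coeff (f ^ 2) 6 * coeff (f ^ 2) 6 ^ 7"
      "coeff (f ^ 16) 96 = coeff (f ^ 2) 12 * coeff (f ^ 2) 12 ^ 7"
      unfolding *
      using coeff_mult_power7_digits[OF deg, of 6 "f ^ 2" 3]
        coeff_mult_power7_digits[OF deg, of 5 "f ^ 2" 10]
      by (simp_all add: big c)
    hence "(- (a^4*b))^8 + (2*a)^8 = 0"
      using hermite[of 1 f 16] pp unfolding c6 c
      by (simp add: card f_def d_def flip: power_Suc)
    moreover have "(- (a^4*b))^8 + (2*a)^8 = a^8 * (a^24 * b^8 - 3) + 7 * (37 * a^8)"
      by Groebner_Basis.algebra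
    ultimately have "a^8 * (a^24 * b^8 - 3) = 0" by (simp only: zero)
    thus ?thesis using a by simp
  qed
  have b0: "b \<noteq> 0" using norm three_nonzero by (auto simp: zero_power)
  have "(a^24)^2 = 1" using power_48[OF a] by (simp flip: power_mult)
  hence s: "a^24 = 1 \<or> a^24 = -1" by (simp only: power2_eq_1_iff)
  have "(1 :: 'a) = 3 * 5 - 2 * 7" by simp
  hence "(5 :: 'a) \<noteq> 0" using seven by (metis diff_self mult_zero_right one_neq_zero)
  hence nz: "(2 :: 'a) \<noteq> 0" "(8 :: 'a) \<noteq> 0" "(5 :: 'a) \<noteq> 0"
    using two_nonzero power_not_zero[OF two_nonzero, of 3] by simp_all
  have "6*b^2 + 2*b + 2 \<noteq> 0"
  proof
    assume 0: "6*b^2 + 2*b + 2 = 0"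
    have "b^8 = (6*b^2 + 2*b + 2) * (1 + 6*b + 5*b^2 + 5*b^3 + b^4 + 5*b^5 + 6*b^6) + 5 + 7 * (-1 - 2*b - 4*b^2 - 8*b^3 - 6*b^4 - 6*b^5 - 4*b^6 - 6*b^7 - 5*b^8)"
      by Groebner_Basis.algebra
    hence "b^8 = 5" unfolding 0 by (simp only: zero) simp
    hence "a^24 * 5 = 3" using norm by simp
    with s have "(5 :: 'a) - 3 = 0 \<or> (5 :: 'a) + 3 = 0"
      by (metis mult_1 mult_minus1 diff_self add.right_inverse)
    thus False using nz by simp
  qed
  moreover have "b \<noteq> 4"
  proof
    assume "b = 4"
    hence "b^8 = 2 + 7 * 9362" by simp
    hence "b^8 = 2" by (simp only: zero)
    hence "a^24 * 2 = 3" using norm by simp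
    with s have "(2 :: 'a) - 3 = 0 \<or> (2 :: 'a) + 3 = 0"
      by (metis mult_1 mult_minus1 diff_self add.right_inverse)
    thus False using nz by simp
  qed
  ultimately show b: "b = 2 \<or> b = 5" using factors b0 by simp
  have "b^8 = 4 + 7 * 36 \<or> b^8 = 4 + 7 * 55803" using b by auto
  hence b8: "b^8 = 4" by (simp only: zero disj_absorb)
  have "a^24 \<noteq> 1"
  proof
    assume "a^24 = 1"
    hence "(4 :: 'a) - 3 = 0" using norm b8 by simp
    thus False by simp
  qed
  thus "a^24 = -1" using s by simp
qed

section \<open>Shifts and scalings of normal forms\<close>

lemma normal_form_pcompose:
  fixes u t :: 'a
  shows "normal_form a\<^sub>5 a\<^sub>4 a\<^sub>3 a\<^sub>2 a\<^sub>1 \<circ>\<^sub>p [:u, t:] =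
    [:u^7 + a\<^sub>5*u^5 + a\<^sub>4*u^4 + a\<^sub>3*u^3 + a\<^sub>2*u^2 + a\<^sub>1*u,
      t * (5*u^4*a\<^sub>5 + 4*u^3*a\<^sub>4 + 3*u^2*a\<^sub>3 + 2*u*a\<^sub>2 + a\<^sub>1),
      t^2 * (10*u^3*a\<^sub>5 + 6*u^2*a\<^sub>4 + 3*u*a\<^sub>3 + a\<^sub>2), t^3 * (10*u^2*a\<^sub>5 + 4*u*a\<^sub>4 + a\<^sub>3),
      t^4 * (5*u*a\<^sub>5 + a\<^sub>4), t^5 * a\<^sub>5, 0, t^7:]"
proof -
  have "normal_form a\<^sub>5 a\<^sub>4 a\<^sub>3 a\<^sub>2 a\<^sub>1 \<circ>\<^sub>p [:u, t:] =
      [:u, t:] ^ 7 + [:0, a\<^sub>1, a\<^sub>2, a\<^sub>3, a\<^sub>4, a\<^sub>5:] \<circ>\<^sub>p [:u, t:]"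
    unfolding normal_form_def
    by (simp only: pcompose_pCons pcompose_0) (simp add: eval_nat_numeral algebra_simps)
  also have "[:u, t:] ^ 7 = ([:u:] + monom t 1) ^ 7" by (simp add: monom_altdef)
  also have "\<dots> = [:u^7:] + monom (t^7) 7"
    unfolding add_power7_poly by (simp add: monom_power poly_const_pow)
  also have "monom (t^7) 7 = [:0, 0, 0, 0, 0, 0, 0, t^7:]"
    by (simp add: monom_altdef eval_nat_numeral)
  finally show ?thesis
    by (simp add: pcompose_pCons) (simp add: eval_nat_numeral algebra_simps)
qed

lemma linearly_related_normal_form_shift:
  fixes u :: 'a
  shows "linearly_related (normal_form a\<^sub>5 a\<^sub>4 a\<^sub>3 a\<^sub>2 a\<^sub>1)
    (normal_form a\<^sub>5 (5*u*a\<^sub>5 + a\<^sub>4) (10*u^2*a\<^sub>5 + 4*u*a\<^sub>4 + a\<^sub>3)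
      (10*u^3*a\<^sub>5 + 6*u^2*a\<^sub>4 + 3*u*a\<^sub>3 + a\<^sub>2)
      (5*u^4*a\<^sub>5 + 4*u^3*a\<^sub>4 + 3*u^2*a\<^sub>3 + 2*u*a\<^sub>2 + a\<^sub>1))"
  unfolding linearly_related_def
  by (rule exI[of _ 1], rule exI[of _ 1], rule exI[of _ u],
      rule exI[of _ "- (u^7 + a\<^sub>5*u^5 + a\<^sub>4*u^4 + a\<^sub>3*u^3 + a\<^sub>2*u^2 + a\<^sub>1*u)"])
     (simp add: normal_form_pcompose, simp add: normal_form_def)

text \<open>Substituting \<open>t x\<close> and dividing by \<open>t^7\<close> gives the coefficient
  of \<open>x^i\<close> the weight \<open>7 - i\<close>.\<close>

lemma linearly_related_normal_form_scale:
  fixes t :: 'a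
  assumes "t \<noteq> 0"
  shows "linearly_related (normal_form (t^2 * a\<^sub>5) (t^3 * a\<^sub>4) (t^4 * a\<^sub>3) (t^5 * a\<^sub>2) (t^6 * a\<^sub>1))
    (normal_form a\<^sub>5 a\<^sub>4 a\<^sub>3 a\<^sub>2 a\<^sub>1)"
  unfolding linearly_related_def
  by (rule exI[of _ "inverse (t ^ 7)"], rule exI[of _ t], rule exI[of _ 0], rule exI[of _ 0])
     (use assms in \<open>simp add: normal_form_pcompose, simp add: normal_form_def field_simps eval_nat_numeral\<close>)

text \<open>The leading coefficient forces \<open>s = t^(-7)\<close>. The shift \<open>u\<close>
  enters the coefficient of \<open>x^4\<close> only through \<open>a\<^sub>5\<close>, and that of
  \<open>x\<close> only through \<open>a\<^sub>5\<close>, \<open>a\<^sub>4\<close> and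
  \<open>a\<^sub>3\<close>; hence the form of the implications.\<close>

lemma linearly_related_normal_formD:
  fixes a\<^sub>5 a\<^sub>4 a\<^sub>3 a\<^sub>1 b\<^sub>5 b\<^sub>4 b\<^sub>3 b\<^sub>1 :: 'a
  assumes "linearly_related (normal_form a\<^sub>5 a\<^sub>4 a\<^sub>3 0 a\<^sub>1) (normal_form b\<^sub>5 b\<^sub>4 b\<^sub>3 0 b\<^sub>1)"
  obtains t where "t \<noteq> 0" "a\<^sub>5 = t^2 * b\<^sub>5" "a\<^sub>5 = 0 \<Longrightarrow> a\<^sub>4 = t^3 * b\<^sub>4"
    "a\<^sub>5 = 0 \<Longrightarrow> a\<^sub>4 = 0 \<Longrightarrow> a\<^sub>3 = 0 \<Longrightarrow> a\<^sub>1 = t^6 * b\<^sub>1"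
proof -
  obtain s t u v where st: "s \<noteq> 0" "t \<noteq> 0" and eq: "normal_form b\<^sub>5 b\<^sub>4 b\<^sub>3 0 b\<^sub>1 =
      smult s (normal_form a\<^sub>5 a\<^sub>4 a\<^sub>3 0 a\<^sub>1 \<circ>\<^sub>p [:u, t:]) + [:v:]"
    using assms by (auto simp: linearly_related_def)
  have c: "1 = s * t^7" "b\<^sub>5 = s * (t^5 * a\<^sub>5)" "b\<^sub>4 = s * (t^4 * (5*u*a\<^sub>5 + a\<^sub>4))"
    "b\<^sub>1 = s * (t * (5*u^4*a\<^sub>5 + 4*u^3*a\<^sub>4 + 3*u^2*a\<^sub>3 + a\<^sub>1))"
    using eq unfolding normal_form_pcompose by (simp_all add: normal_form_def)
  have st7: "t^7 * s = 1" using c(1) by (simp add: mult.commute)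
  have "t^2 * b\<^sub>5 = (t^7 * s) * a\<^sub>5" unfolding c by (simp add: eval_nat_numeral)
  moreover have "a\<^sub>5 = 0 \<Longrightarrow> t^3 * b\<^sub>4 = (t^7 * s) * a\<^sub>4"
    unfolding c by (simp add: eval_nat_numeral)
  moreover have "a\<^sub>5 = 0 \<Longrightarrow> a\<^sub>4 = 0 \<Longrightarrow> a\<^sub>3 = 0 \<Longrightarrow> t^6 * b\<^sub>1 = (t^7 * s) * a\<^sub>1"
    unfolding c by (simp add: eval_nat_numeral)
  ultimately show ?thesis using that[of t] st st7 by simp
qed

section \<open>The generator of the multiplicative group\<close>

lemma e_power_neq_1:
  assumes "0 < i" "i < 48"
  shows "e ^ i \<noteq> 1"
proof
  assume i: "e ^ i = 1"
  obtain x y where xy: "i * x = 48 * y + gcd i 48"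
    using bezout_nat[of i 48] assms by auto
  have "e ^ (48 * y + gcd i 48) = 1" by (simp only: xy[symmetric] power_mult i power_one)
  hence g: "e ^ gcd i 48 = 1" using power_48[OF e_nonzero] by (simp add: power_add power_mult)
  have "gcd i 48 \<le> i" using assms by (intro gcd_le1_nat) simp
  hence "gcd i 48 \<le> 47" using assms by linarith
  hence "gcd i 48 \<in> {d \<in> {1..47}. d dvd 48}" using assms by (auto simp: Suc_le_eq)
  also have "{d \<in> {1..47}. d dvd 48} = {1, 2, 3, 4, 6, 8, 12, 16, 24 :: nat}" by code_simp
  \<comment> \<open>16 and 24 are the maximal proper divisors of 48, so it suffices that neither of
    these two powers of \<open>e\<close> is 1.\<close>
  finally have "gcd i 48 dvd 16 \<or> gcd i 48 dvd 24" by auto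
  hence "e ^ 16 = 1 \<or> e ^ 24 = 1" using g by (metis dvdE power_mult power_one)
  moreover have "e ^ 16 - 1 \<noteq> 0" by (simp add: e_power16)
  moreover have "e ^ 24 \<noteq> 1"
  proof
    assume "e ^ 24 = 1"
    hence "(2 :: 'a) = 1 - e ^ 24" by (simp add: e_power24)
    thus False using \<open>e ^ 24 = 1\<close> two_nonzero by simp
  qed
  ultimately show False by auto
qed

lemma eq_power_e:
  fixes a :: 'a
  assumes "a \<noteq> 0"
  obtains k where "a = e ^ k"
proof -
  have neq: "e ^ i \<noteq> e ^ j" if "i < j" "j < 48" for i j
  proof
    assume "e ^ i = e ^ j"
    moreover have "e ^ j = e ^ i * e ^ (j - i)" using that by (simp flip: power_add)
    ultimately have "e ^ (j - i) = 1" using e_nonzero by simp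
    thus False using e_power_neq_1[of "j - i"] that by simp
  qed
  have inj: "inj_on (\<lambda>k. e ^ k) {..<48}"
    by (rule inj_onI) (metis neq lessThan_iff linorder_neqE_nat)
  have "(\<lambda>k. e ^ k) ` {..<48} = UNIV - {0}"
  proof (rule card_subset_eq)
    show "card ((\<lambda>k. e ^ k) ` {..<48}) = card (UNIV - {0 :: 'a})"
      using inj by (simp add: card_image card_Diff_singleton card)
  qed (use e_nonzero in auto)
  hence "a \<in> (\<lambda>k. e ^ k) ` {..<48}" using assms by simp
  thus ?thesis using that by auto
qed

text \<open>Dividing the exponent of \<open>e\<close> by \<open>n\<close> with remainder shows that
  \<open>e^0, ..., e^(n-1)\<close> meet every coset of the \<open>n\<close>-th powers.\<close>

lemma eq_power_mult_power_e:
  fixes a :: 'a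
  assumes "a \<noteq> 0" "n > 0"
  obtains t i where "t \<noteq> 0" "i < n" "a = t ^ n * e ^ i"
proof -
  obtain k where k: "a = e ^ k" using assms eq_power_e by blast
  have "e ^ k = (e ^ (k div n)) ^ n * e ^ (k mod n)"
    by (simp add: mult.commute flip: power_mult power_add)
  thus ?thesis using that[of "e ^ (k div n)" "k mod n"] assms e_nonzero k by simp
qed

definition exceptional_representatives :: "'a poly set" where
  "exceptional_representatives =
    {normal_form 0 0 0 0 a | a. a \<in> {0, e, e^2, e^3, e^4, e^5}}
    \<union> {normal_form 0 1 0 0 2, normal_form 0 (e^2) 0 0 (2 * e^4)}
    \<union> {normal_form e 0 (5 * e^2) 0 (6 * e^3)}"

text \<open>In characteristic 7 no shift removes the term of degree 6 from a septic. Instead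
  Hermite's criterion for exponent 8 says that the eighth power of its coefficient is 0.\<close>

lemma linearly_related_normal_form:
  fixes f :: "'a poly"
  assumes f: "degree f = 7" and pp: "permutation_polynomial_ext 1 f"
  obtains a\<^sub>5 a\<^sub>4 a\<^sub>3 a\<^sub>2 a\<^sub>1 where "linearly_related f (normal_form a\<^sub>5 a\<^sub>4 a\<^sub>3 a\<^sub>2 a\<^sub>1)"
proof -
  define l where "l = coeff f 7"
  have l: "l \<noteq> 0" using f unfolding l_def by (metis leading_coeff_0_iff degree_0 zero_neq_numeral)
  define g where "g = smult (1 / l) f + [:- coeff f 0 / l:]"
  have fg: "linearly_related f g"
    unfolding linearly_related_def
    by (rule exI[of _ "1 / l"], rule exI[of _ 1], rule exI[of _ 0], rule exI[of _ "- coeff f 0 / l"])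
       (use l in \<open>simp add: g_def pcompose_idR\<close>)
  have pp': "permutation_polynomial_ext 1 g"
    by (rule permutation_polynomial_ext_linearly_related[OF fg _ pp]) simp
  have g: "coeff g 7 = 1" "coeff g 0 = 0" "\<And>n. n > 7 \<Longrightarrow> coeff g n = 0"
    using l f by (simp_all add: g_def l_def coeff_pCons coeff_eq_0 split: nat.splits)
  have deg: "degree g = 7"
    using g by (intro antisym degree_le le_degree) auto
  have "coeff g 6 * coeff g 6 ^ 7 = 0"
  proof -
    have *: "{..6} = {0, 1, 2, 3, 4, 5, 6 :: nat}" by auto
    show ?thesis using hermite49[OF pp' deg, of 1] by (simp add: * g)
  qed
  hence g6: "coeff g 6 = 0" by simp
  have "g = normal_form (coeff g 5) (coeff g 4) (coeff g 3) (coeff g 2) (coeff g 1)"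
  proof (rule poly_eqI)
    fix n
    show "coeff g n = coeff (normal_form (coeff g 5) (coeff g 4) (coeff g 3) (coeff g 2) (coeff g 1)) n"
    proof (cases "n > 7")
      case False
      hence "n \<in> {0, 1, 2, 3, 4, 5, 6, 7}" by auto
      thus ?thesis using g g6 unfolding normal_form_def
        by (elim insertE emptyE) (simp_all only: coeff_mult_simps)
    qed (simp add: g coeff_eq_0)
  qed
  thus ?thesis using that fg by metis
qed

text \<open>Exponent 10 expresses \<open>d\<close> through \<open>a\<close> and \<open>b\<close>,
  after which the two lemmas on this case apply. Since \<open>a^24 = -1\<close>, \<open>a\<close> is
  not a square, so scaling makes it \<open>e\<close>. The two possible values 2 and 5 of
  \<open>b / a^2\<close> give \<open>special\<close> and the last representative.\<close>

lemma classification_a5: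
  fixes a :: 'a
  assumes a: "a \<noteq> 0" and pp: "permutation_polynomial_ext 1 (normal_form a 0 b c d)"
  shows "linearly_related (normal_form a 0 b c d) special \<or>
    (\<exists>g\<in>exceptional_representatives. linearly_related (normal_form a 0 b c d) g)"
proof -
  note zero = seven mult_zero_left mult_zero_right add_0_right
  define r where "r = b / a^2"
  have b: "b = r * a^2" using a by (simp add: r_def)
  have "coeff (normal_form a 0 b c d ^ 3) n = 0" if "n > 21" for n
    using degree_power_le[of "normal_form a 0 b c d" 3] that by (intro coeff_eq_0) simp
  moreover have "coeff (normal_form a 0 b c d ^ 3) 13 = 3*a^2*b + 6*a*d + 3*b^2"
    unfolding normal_form_power3 by (simp add: coeff_pCons_numeral)
  ultimately have "(3*a^2*b + 6*a*d + 3*b^2) * a^7 = 0"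
    using hermite49_normal_form[OF refl pp, of 3] by simp
  hence "3*a^2*b + 6*a*d + 3*b^2 = 0" using a by simp
  moreover have "3*a^2*b + 6*a*d + 3*b^2 = a * ((3*r^2 + 3*r)*a^3 - d) + 7 * (a * d)"
    unfolding b by Groebner_Basis.algebra
  ultimately have "a * ((3*r^2 + 3*r)*a^3 - d) = 0" by (simp only: zero)
  hence d: "d = (3*r^2 + 3*r)*a^3" using a by simp
  have "c = 0" using normal_form_a5_a2_eq_0 pp a unfolding b d by blast
  hence f: "normal_form a 0 b c d = normal_form a 0 (r*a^2) 0 ((3*r^2 + 3*r)*a^3)"
    by (simp add: b d)
  have a24: "a^24 = -1" and r: "r = 2 \<or> r = 5"
    using normal_form_a5_a2_zero pp a unfolding f by blast+
  obtain t i where t: "t \<noteq> 0" "i < 2" "a = t^2 * e^i" using eq_power_mult_power_e[OF a, of 2] by auto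
  have "a^24 = t^48 * e^(24 * i)" unfolding t(3) by (simp add: power_mult_distrib mult.commute flip: power_mult)
  moreover have "(1 :: 'a) \<noteq> -1" using two_nonzero by (simp add: eq_neg_iff_add_eq_0)
  ultimately have "i \<noteq> 0" using a24 power_48[OF t(1)] by (metis mult_0_right mult_1 power_0)
  hence a: "a = t^2 * e" using t by (cases "i = 1") auto
  note scale = linearly_related_normal_form_scale[OF t(1)]
  from r show ?thesis
  proof
    assume r: "r = 2"
    have "(3*r^2 + 3*r)*a^3 = t^6 * (4 * e^3) + 7 * (2 * t^6 * e^3)"
      unfolding r a by Groebner_Basis.algebra
    hence d: "(3*r^2 + 3*r)*a^3 = t^6 * (4 * e^3)" by (simp only: zero)
    have "normal_form a 0 b c d = normal_form (t^2 * e) (t^3 * 0) (t^4 * (2 * e^2)) (t^5 * 0) (t^6 * (4 * e^3))"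
      unfolding f d by (simp add: r a power_mult_distrib mult.left_commute flip: power_mult)
    thus ?thesis unfolding special_def using scale by metis
  next
    assume r: "r = 5"
    have "(3*r^2 + 3*r)*a^3 = t^6 * (6 * e^3) + 7 * (12 * t^6 * e^3)"
      unfolding r a by Groebner_Basis.algebra
    hence d: "(3*r^2 + 3*r)*a^3 = t^6 * (6 * e^3)" by (simp only: zero)
    have "normal_form a 0 b c d = normal_form (t^2 * e) (t^3 * 0) (t^4 * (5 * e^2)) (t^5 * 0) (t^6 * (6 * e^3))"
      unfolding f d by (simp add: r a power_mult_distrib mult.left_commute flip: power_mult)
    hence "linearly_related (normal_form a 0 b c d) (normal_form e 0 (5 * e^2) 0 (6 * e^3))"
      using scale by metis
    thus ?thesis unfolding exceptional_representatives_def by blast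
  qed
qed

lemma permutation_polynomial_ext_1D:
  fixes f :: "'a poly"
  assumes "permutation_polynomial_ext 1 f" "poly f x = poly f y"
  shows "x = y"
proof -
  have "inj_on (poly (map_poly to_ac f)) (ext_field 1)"
    using assms(1) by (simp add: permutation_polynomial_ext_def bij_betw_def)
  moreover have "poly (map_poly to_ac f) (to_ac x) = poly (map_poly to_ac f) (to_ac y)"
    by (simp only: poly_map_poly_to_ac assms)
  ultimately have "to_ac x = to_ac y" using to_ac_in_ext_field by (metis inj_onD)
  thus ?thesis by simp
qed

text \<open>Exponent 11 gives \<open>c = 0\<close>, and exponent 12 becomes
  \<open>2 * a^8 * (d - 2*a^2)^2 = 0\<close>. Scaling leaves \<open>a = e^i\<close> with
  \<open>i < 3\<close>, and \<open>i = 1\<close> is refuted by a nonzero root.\<close>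

lemma classification_a4:
  fixes a :: 'a
  assumes a: "a \<noteq> 0" and pp: "permutation_polynomial_ext 1 (normal_form 0 a 0 c d)"
  shows "\<exists>g\<in>exceptional_representatives. linearly_related (normal_form 0 a 0 c d) g"
proof -
  note zero = seven mult_zero_left mult_zero_right add_0_right
  have "coeff (normal_form 0 a 0 c d ^ 4) 34 = 0"
    using degree_power_le[of "normal_form 0 a 0 c d" 4] by (intro coeff_eq_0) simp
  hence "(12 * a * c) * a^7 = 0"
    using hermite49_normal_form[OF refl pp, of 4, unfolded coeff_normal_form_power4'] by simp
  moreover have "(12 :: 'a) \<noteq> 0"
    using no_zero_divisors[OF three_nonzero power_not_zero[OF two_nonzero, of 2]] by simp
  ultimately have c: "c = 0" using a by simp
  have "(30*a*d^2 + 20*a^3*d + a^5) * a^7 = 0"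
    using hermite49_normal_form[OF refl pp, of 5, unfolded coeff_normal_form_power5'] c by simp
  moreover have "(30*a*d^2 + 20*a^3*d + a^5) * a^7
      = 2 * a^8 * (d - 2*a^2)^2 + 7 * (a^8 * (4*d^2 + 4*a^2*d - a^4))"
    by Groebner_Basis.algebra
  ultimately have "2 * a^8 * (d - 2*a^2)^2 = 0" by (simp only: zero)
  hence d: "d = 2 * a^2" using a two_nonzero by simp
  obtain t i where t: "t \<noteq> 0" "i < 3" "a = t^3 * e^i" using eq_power_mult_power_e[OF a, of 3] by auto
  have scaled: "normal_form 0 a 0 c d =
      normal_form (t^2 * 0) (t^3 * e^i) (t^4 * 0) (t^5 * 0) (t^6 * (2 * (e^i)^2))"
    by (simp add: c d t(3) power_mult_distrib mult.left_commute flip: power_mult)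
  have related: "linearly_related (normal_form 0 a 0 c d) (normal_form 0 (e^i) 0 0 (2 * (e^i)^2))"
    unfolding scaled by (rule linearly_related_normal_form_scale[OF t(1)])
  have "i \<noteq> 1"
  proof
    assume i: "i = 1"
    \<comment> \<open>As \<open>e^8 = 3\<close>, the last factor is \<open>2 + 3 + 9 = 14\<close>,
      so \<open>t * e^3\<close> collides with 0.\<close>
    have "poly (normal_form 0 a 0 c d) (t * e^3) = t^7 * e^5 * (2 + e^8 + (e^8)^2)"
      unfolding c d t(3) i normal_form_def by (simp add: algebra_simps eval_nat_numeral)
    also have "\<dots> = 7 * (2 * t^7 * e^5)" unfolding e_power8 by simp
    also have "\<dots> = poly (normal_form 0 a 0 c d) 0" by (simp add: seven normal_form_def)
    finally have "t * e^3 = 0" by (rule permutation_polynomial_ext_1D[OF pp])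
    thus False using t e_nonzero by simp
  qed
  hence "i = 0 \<or> i = 2" using t(2) by auto
  thus ?thesis using related unfolding exceptional_representatives_def
    by (auto simp flip: power_mult)
qed

text \<open>Exponent 12 reduces to \<open>3 * b^9 = 0\<close>. With \<open>b = 0\<close>, everything
  except \<open>c * x^2\<close> is additive, so \<open>c \<noteq> 0\<close> yields two arguments at
  distance 1 with equal values. For \<open>c = 0\<close>, \<open>d\<close> matters only modulo sixth
  powers.\<close>

lemma classification_a3:
  fixes b :: 'a
  assumes pp: "permutation_polynomial_ext 1 (normal_form 0 0 b c d)"
  shows "\<exists>g\<in>exceptional_representatives. linearly_related (normal_form 0 0 b c d) g"
proof -
  note zero = seven mult_zero_left mult_zero_right add_0_right
  have "(10 * b^2) * b^7 = 0"
    using hermite49_normal_form[OF refl pp, of 5, unfolded coeff_normal_form_power5] by simp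
  hence "3 * b^9 + 7 * b^9 = 0" by (simp add: eval_nat_numeral algebra_simps)
  hence "3 * b^9 = 0" by (simp only: zero)
  hence b: "b = 0" using three_nonzero by simp
  have c: "c = 0"
  proof (rule ccontr)
    assume c: "c \<noteq> 0"
    \<comment> \<open>The solution of the linear equation \<open>f (x + 1) = f x\<close>.\<close>
    define x where "x = - (1 + c + d) / (2 * c)"
    have x: "2 * c * x = - (1 + c + d)" using c two_nonzero by (simp add: x_def)
    have eval: "poly (normal_form 0 0 b c d) y = y^7 + c * y^2 + d * y" for y
      by (simp add: b normal_form_def algebra_simps eval_nat_numeral)
    have "poly (normal_form 0 0 b c d) (x + 1) = poly (normal_form 0 0 b c d) x + (2 * c * x + (1 + c + d))"
      unfolding eval add_power_7[OF seven] by (simp add: power2_sum algebra_simps)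
    also have "\<dots> = poly (normal_form 0 0 b c d) x" unfolding x by simp
    finally have "x + 1 = x" by (rule permutation_polynomial_ext_1D[OF pp])
    thus False by simp
  qed
  show ?thesis
  proof (cases "d = 0")
    case True
    have "linearly_related (normal_form 0 0 b c d) (normal_form 0 0 0 0 0)"
      using linearly_related_normal_form_scale[of 1 0 0 0 0 0] by (simp add: b c True)
    thus ?thesis unfolding exceptional_representatives_def by auto
  next
    case False
    obtain t i where t: "t \<noteq> 0" "i < 6" "d = t^6 * e^i" using eq_power_mult_power_e[OF False, of 6] by auto
    have scaled: "normal_form 0 0 b c d =
        normal_form (t^2 * 0) (t^3 * 0) (t^4 * 0) (t^5 * 0) (t^6 * e^i)"
      by (simp add: b c t(3))
    have related: "linearly_related (normal_form 0 0 b c d) (normal_form 0 0 0 0 (e^i))"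
      unfolding scaled by (rule linearly_related_normal_form_scale[OF t(1)])
    have "i \<noteq> 0"
    proof
      assume i: "i = 0"
      \<comment> \<open>Since \<open>e^24 = -1\<close>, \<open>-t^6\<close> is the sixth power of
        \<open>t * e^4\<close>, which is therefore a second root besides 0.\<close>
      have "poly (normal_form 0 0 b c d) (t * e^4) = t^7 * e^4 * (e^24 + 1)"
        unfolding b c t(3) i normal_form_def by (simp add: algebra_simps eval_nat_numeral)
      also have "\<dots> = poly (normal_form 0 0 b c d) 0" by (simp add: e_power24 normal_form_def)
      finally have "t * e^4 = 0" by (rule permutation_polynomial_ext_1D[OF pp])
      thus False using t e_nonzero by simp
    qed
    hence "i \<in> {1, 2, 3, 4, 5}" using t(2) by auto
    thus ?thesis using related unfolding exceptional_representatives_def by auto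
  qed
qed

lemma classification:
  fixes f :: "'a poly"
  assumes f: "degree f = 7" and pp: "permutation_polynomial_ext 1 f"
  shows "linearly_related f special \<or> (\<exists>g\<in>exceptional_representatives. linearly_related f g)"
proof -
  obtain a\<^sub>5 a\<^sub>4 a\<^sub>3 a\<^sub>2 a\<^sub>1 where fg: "linearly_related f (normal_form a\<^sub>5 a\<^sub>4 a\<^sub>3 a\<^sub>2 a\<^sub>1)"
    using linearly_related_normal_form[OF f pp] .
  show ?thesis
  proof (cases "a\<^sub>5 = 0")
    case False
    define u where "u = - a\<^sub>4 / (5 * a\<^sub>5)"
    have "(1 :: 'a) = 3 * 5 - 2 * 7" by simp
    hence "(5 :: 'a) \<noteq> 0" using seven by (metis diff_self mult_zero_right one_neq_zero)
    hence u: "5 * u * a\<^sub>5 + a\<^sub>4 = 0" using False by (simp add: u_def)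
    obtain b c d where fg': "linearly_related f (normal_form a\<^sub>5 0 b c d)"
      using linearly_related_trans[OF fg linearly_related_normal_form_shift[of _ _ _ _ _ u]]
      unfolding u by blast
    have "permutation_polynomial_ext 1 (normal_form a\<^sub>5 0 b c d)"
      by (rule permutation_polynomial_ext_linearly_related[OF fg' _ pp]) simp
    thus ?thesis using classification_a5[OF False] linearly_related_trans[OF fg'] by blast
  next
    case a5: True
    show ?thesis
    proof (cases "a\<^sub>4 = 0")
      case False
      define u where "u = - a\<^sub>3 / (4 * a\<^sub>4)"
      have "(4 :: 'a) \<noteq> 0" using power_not_zero[OF two_nonzero, of 2] by simp
      hence u: "10 * u^2 * 0 + 4 * u * a\<^sub>4 + a\<^sub>3 = 0" "5 * u * 0 + a\<^sub>4 = a\<^sub>4"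
        using False by (simp_all add: u_def)
      obtain c d where fg': "linearly_related f (normal_form 0 a\<^sub>4 0 c d)"
        using linearly_related_trans[OF fg linearly_related_normal_form_shift[of _ _ _ _ _ u]]
        unfolding a5 u by blast
      have "permutation_polynomial_ext 1 (normal_form 0 a\<^sub>4 0 c d)"
        by (rule permutation_polynomial_ext_linearly_related[OF fg' _ pp]) simp
      thus ?thesis using classification_a4[OF False] linearly_related_trans[OF fg'] by blast
    next
      case a4: True
      have "permutation_polynomial_ext 1 (normal_form a\<^sub>5 a\<^sub>4 a\<^sub>3 a\<^sub>2 a\<^sub>1)"
        by (rule permutation_polynomial_ext_linearly_related[OF fg _ pp]) simp
      thus ?thesis using classification_a3 linearly_related_trans[OF fg] unfolding a5 a4 by blast
    qed
  qed
qed

section \<open>Uniqueness of the representatives\<close>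

lemma power_e_eq_1_iff: "e ^ k = 1 \<longleftrightarrow> 48 dvd k"
proof -
  have "e ^ k = (e ^ 48) ^ (k div 48) * e ^ (k mod 48)" by (simp flip: power_mult power_add)
  hence *: "e ^ k = e ^ (k mod 48)" using power_48[OF e_nonzero] by simp
  show ?thesis
  proof (cases "k mod 48 = 0")
    case False
    hence "e ^ (k mod 48) \<noteq> 1" by (intro e_power_neq_1) auto
    thus ?thesis using False by (simp add: * dvd_eq_mod_eq_0)
  qed (use * in \<open>simp add: dvd_eq_mod_eq_0\<close>)
qed

text \<open>If \<open>e^(j - i)\<close> is an \<open>n\<close>-th power, raising it to
  \<open>48 div n\<close> gives 1, so \<open>n\<close> divides \<open>j - i\<close>, which is
  smaller than \<open>n\<close>.\<close>

lemma power_e_cosets_disjoint: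
  assumes eq: "e ^ i = t ^ n * e ^ j" and t: "t \<noteq> 0" and n: "n dvd 48" and ij: "i < n" "j < n"
  shows "i = j"
proof -
  obtain l where l: "48 = n * l" using n by (rule dvdE)
  have neq: "\<not> (\<exists>t. t \<noteq> 0 \<and> e ^ j = t ^ n * e ^ i)" if "i < j" "j < n" for i j
  proof
    assume "\<exists>t. t \<noteq> 0 \<and> e ^ j = t ^ n * e ^ i"
    then obtain t where t: "t \<noteq> 0" "e ^ j = t ^ n * e ^ i" by blast
    moreover have "e ^ j = e ^ (j - i) * e ^ i" using that by (simp flip: power_add)
    ultimately have "e ^ (j - i) = t ^ n" using e_nonzero by simp
    hence "e ^ ((j - i) * l) = t ^ 48" by (simp only: power_mult l)
    hence "48 dvd (j - i) * l" using power_48[OF t(1)] power_e_eq_1_iff by simp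
    hence "n dvd j - i" using l by (metis dvd_mult_cancel2 dvd_times_right_cancel_iff mult_eq_0_iff zero_neq_numeral)
    thus False using that by (auto dest: dvd_imp_le)
  qed
  have "e ^ j = (inverse t) ^ n * e ^ i" using eq t by (simp add: power_inverse)
  moreover have "inverse t \<noteq> 0" using t by simp
  ultimately show ?thesis using neq[of i j] neq[of j i] eq t ij by (metis linorder_neqE_nat)
qed

text \<open>Linear relation preserves whether \<open>a\<^sub>5\<close> vanishes, then the class of
  \<open>a\<^sub>4\<close> modulo cubes, and, if both vanish together with \<open>a\<^sub>3\<close>,
  the class of \<open>a\<^sub>1\<close> modulo sixth powers. These data separate the
  representatives.\<close>

lemma exceptional_representatives_unique:
  assumes fg: "linearly_related f g" and f: "f \<in> exceptional_representatives"
    and g: "g \<in> exceptional_representatives"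
  shows "f = g"
proof -
  define A where "A = {0, e, e^2, e^3, e^4, e^5}"
  \<comment> \<open>The tuples list the coefficients of \<open>x^5\<close>, \<open>x^4\<close>,
    \<open>x^3\<close> and \<open>x\<close>; that of \<open>x^2\<close> is always 0.\<close>
  define B where "B = {(0, 0, 0, a) | a. a \<in> A} \<union>
    {(0, 1, 0, 2), (0, e^2, 0, 2 * e^4)} \<union> {(e, 0, 5 * e^2, 6 * e^3)}"
  have B: "\<exists>a\<^sub>5 a\<^sub>4 a\<^sub>3 a\<^sub>1. h = normal_form a\<^sub>5 a\<^sub>4 a\<^sub>3 0 a\<^sub>1 \<and> (a\<^sub>5, a\<^sub>4, a\<^sub>3, a\<^sub>1) \<in> B"
    if "h \<in> exceptional_representatives" for h
    using that unfolding exceptional_representatives_def A_def[symmetric] B_def by auto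
  obtain a\<^sub>5 a\<^sub>4 a\<^sub>3 a\<^sub>1 where a: "f = normal_form a\<^sub>5 a\<^sub>4 a\<^sub>3 0 a\<^sub>1" "(a\<^sub>5, a\<^sub>4, a\<^sub>3, a\<^sub>1) \<in> B"
    using B[OF f] by blast
  obtain b\<^sub>5 b\<^sub>4 b\<^sub>3 b\<^sub>1 where b: "g = normal_form b\<^sub>5 b\<^sub>4 b\<^sub>3 0 b\<^sub>1" "(b\<^sub>5, b\<^sub>4, b\<^sub>3, b\<^sub>1) \<in> B"
    using B[OF g] by blast
  obtain t where t: "t \<noteq> 0" "a\<^sub>5 = t^2 * b\<^sub>5" "a\<^sub>5 = 0 \<Longrightarrow> a\<^sub>4 = t^3 * b\<^sub>4"
    "a\<^sub>5 = 0 \<Longrightarrow> a\<^sub>4 = 0 \<Longrightarrow> a\<^sub>3 = 0 \<Longrightarrow> a\<^sub>1 = t^6 * b\<^sub>1"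
    using linearly_related_normal_formD fg unfolding a(1) b(1) by blast
  have cube: "e ^ 2 \<noteq> t ^ 3" "1 \<noteq> t ^ 3 * e ^ 2"
    using power_e_cosets_disjoint[of 2 t 3 0] power_e_cosets_disjoint[of 0 t 3 2] t(1) by auto
  have A: "x = y" if xy: "x \<in> A" "y \<in> A" "x = t ^ 6 * y" for x y
  proof (cases "y = 0")
    case False
    have *: "\<exists>i<6. z = e ^ i" if "z \<in> A" "z \<noteq> 0" for z
    proof -
      have "z \<in> {e^1, e^2, e^3, e^4, e^5}" using that by (simp add: A_def)
      thus ?thesis by (elim insertE emptyE) (rule exI, rule conjI[rotated], assumption, simp)+
    qed
    obtain i j where "i < 6" "j < 6" "x = e ^ i" "y = e ^ j"
      using *[of x] *[of y] xy False t(1) by auto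
    thus ?thesis using power_e_cosets_disjoint[of i t 6 j] xy(3) t(1) by simp
  qed (use xy in simp)
  show ?thesis
  proof (cases "a\<^sub>5 = 0")
    case True
    hence b5: "b\<^sub>5 = 0" using t by simp
    have a': "a\<^sub>3 = 0" "a\<^sub>4 = 0 \<and> a\<^sub>1 \<in> A \<or> a\<^sub>4 = 1 \<and> a\<^sub>1 = 2 \<or> a\<^sub>4 = e^2 \<and> a\<^sub>1 = 2 * e^4"
      using a(2) True e_nonzero unfolding B_def by auto
    have b': "b\<^sub>3 = 0" "b\<^sub>4 = 0 \<and> b\<^sub>1 \<in> A \<or> b\<^sub>4 = 1 \<and> b\<^sub>1 = 2 \<or> b\<^sub>4 = e^2 \<and> b\<^sub>1 = 2 * e^4"
      using b(2) b5 e_nonzero unfolding B_def by auto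
    have "a\<^sub>4 = 0 \<longleftrightarrow> b\<^sub>4 = 0" "\<not> (a\<^sub>4 = 1 \<and> b\<^sub>4 = e^2)" "\<not> (a\<^sub>4 = e^2 \<and> b\<^sub>4 = 1)"
      using t(3)[OF True] t(1) cube by auto
    hence a4: "a\<^sub>4 = b\<^sub>4" using a'(2) b'(2) by metis
    have "a\<^sub>1 = b\<^sub>1"
    proof (cases "a\<^sub>4 = 0")
      case 0: True
      hence "a\<^sub>1 \<in> A" "b\<^sub>1 \<in> A" using a'(2) b'(2) a4 e_nonzero by auto
      thus ?thesis using A t(4)[OF True 0 a'(1)] by blast
    next
      case False
      thus ?thesis
        using a'(2) b'(2) a4 cube power_e_eq_1_iff[of 2] by auto
    qed
    hence "a\<^sub>4 = b\<^sub>4 \<and> a\<^sub>3 = b\<^sub>3 \<and> a\<^sub>1 = b\<^sub>1" using a4 a'(1) b'(1) by simp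
    thus ?thesis using a b True b5 by simp
  next
    case False
    hence "b\<^sub>5 \<noteq> 0" using t by simp
    thus ?thesis using a b False unfolding B_def by auto
  qed
qed

section \<open>Exceptionality of the representatives\<close>

lemma exceptional_monom_7: "exceptional (monom 1 7 :: 'a poly)"
proof -
  \<comment> \<open>This is the case \<open>b = 0\<close> excluded in
    \<open>exceptional_mult_power\<close>; the Frobenius map is injective on every
    extension.\<close>
  have "permutation_polynomial_ext m (monom 1 7 :: 'a poly)" if m: "m > 0" for m
  proof -
    define K :: "'a alg_closure set" where "K = ext_field m"
    have ev: "poly (map_poly to_ac (monom 1 7 :: 'a poly)) x = x ^ 7" for x
      by (simp add: map_poly_monom poly_monom)
    have fin: "finite K"
      using card_ext_field[OF m, where 'a = 'a] card_gt_1[where 'a = 'a]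
      unfolding K_def by (intro card_ge_0_finite) simp
    have "inj_on (\<lambda>x. x ^ 7) K"
    proof (rule inj_onI)
      fix x y :: "'a alg_closure" assume "x ^ 7 = y ^ 7"
      hence "(x - y) ^ 7 = 0" using add_power_7[OF seven_ac, of "x - y" y] by simp
      thus "x = y" by simp
    qed
    moreover have "(\<lambda>x. x ^ 7) ` K \<subseteq> K"
    proof clarify
      fix x assume "x \<in> K"
      hence "x ^ n \<in> K" for n unfolding K_def by (induction n) (auto intro: ext_field_1 ext_field_mult)
      thus "x ^ 7 \<in> K" .
    qed
    ultimately have "bij_betw (\<lambda>x. x ^ 7) K K" using fin by (simp add: bij_betw_def endo_inj_surj)
    thus ?thesis by (simp add: permutation_polynomial_ext_def K_def ev[abs_def])
  qed
  hence "{m. m > 0 \<and> permutation_polynomial_ext m (monom 1 7 :: 'a poly)} = {0<..}" by auto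
  thus ?thesis unfolding exceptional_def by (simp add: infinite_Ioi)
qed

lemma normal_form_eq_mult_power:
  fixes b :: 'a
  shows "monom 1 1 * (monom 1 6 + [:b:]) ^ 1 = normal_form 0 0 0 0 b"
    and "monom 1 1 * (monom 1 3 + [:b:]) ^ 2 = normal_form 0 (2 * b) 0 0 (b^2)"
    and "monom 1 1 * (monom 1 2 + [:b:]) ^ 3 = normal_form (3 * b) 0 (3 * b^2) 0 (b^3)"
  by (simp_all add: normal_form_def monom_altdef eval_nat_numeral algebra_simps)

text \<open>The even exponent \<open>48 div k\<close> removes the sign of \<open>- b\<close>, and
  the last condition says that \<open>k\<close> does not divide \<open>j\<close>.\<close>

lemma exceptional_mult_power_e:
  assumes "k * r = 6" "even (48 div k)" "\<not> 48 dvd j * (48 div k)"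
  shows "exceptional (monom 1 1 * (monom 1 k + [:e ^ j:]) ^ r)"
  using assms by (intro exceptional_mult_power) (simp_all add: e_nonzero power_e_eq_1_iff flip: power_mult)

text \<open>Apart from \<open>x^7\<close>, each representative is \<open>x (x^k + b)^r\<close> with
  \<open>b = e^j\<close> and \<open>k\<close> not dividing \<open>j\<close>:
  \<open>j = 1, ..., 5\<close> for \<open>k = 6\<close>, \<open>j = 32, 34\<close> for
  \<open>k = 3\<close> and \<open>j = 41\<close> for \<open>k = 2\<close>. The last three come from
  \<open>2 * b = 1\<close>, \<open>2 * b = e^2\<close> and \<open>3 * b = e\<close>.\<close>

lemma exceptional_exceptional_representatives:
  assumes "g \<in> exceptional_representatives"
  shows "exceptional g"
proof -
  note zero = seven mult_zero_left mult_zero_right add_0_right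
  have "e ^ 32 = (e ^ 16)^2" by simp
  hence e32: "e ^ 32 = 4" by (simp add: e_power16)
  have "e ^ 40 = e ^ 32 * e ^ 8" by (simp flip: power_add)
  also have "\<dots> = 5 + 7 * 1" by (simp add: e32 e_power8)
  finally have e40: "e ^ 40 = 5" by (simp only: zero)
  have "e ^ 34 = e ^ 32 * e ^ 2" "e ^ 41 = e ^ 40 * e" by (simp_all flip: power_add power_Suc2)
  hence e34: "e ^ 34 = 4 * e ^ 2" and e41: "e ^ 41 = 5 * e" by (simp_all only: e32 e40)
  have "normal_form 0 0 0 0 0 = (monom 1 7 :: 'a poly)"
    by (simp add: normal_form_def monom_altdef eval_nat_numeral)
  hence "exceptional (normal_form 0 0 0 0 (0 :: 'a))" using exceptional_monom_7 by simp
  moreover have "exceptional (normal_form 0 0 0 0 (e ^ i))" if "0 < i" "i < 6" for i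
    using exceptional_mult_power_e[of 6 1 i] that nat_dvd_not_less[of i 6] unfolding normal_form_eq_mult_power by simp
  from this[of 1] this[of 2] this[of 3] this[of 4] this[of 5]
  have "exceptional (normal_form 0 0 0 0 e)" "exceptional (normal_form 0 0 0 0 (e^2))"
    "exceptional (normal_form 0 0 0 0 (e^3))" "exceptional (normal_form 0 0 0 0 (e^4))"
    "exceptional (normal_form 0 0 0 0 (e^5))" by simp_all
  moreover have "exceptional (normal_form 0 1 0 0 (2 :: 'a))"
  proof -
    have "2 * e ^ 32 = 1 + 7 * 1" "(e ^ 32)^2 = 2 + 7 * 2" by (simp_all add: e32)
    hence "2 * e ^ 32 = 1" "(e ^ 32)^2 = 2" by (simp_all only: zero)
    thus ?thesis using exceptional_mult_power_e[of 3 2 32] unfolding normal_form_eq_mult_power by simp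
  qed
  moreover have "exceptional (normal_form 0 (e^2) 0 0 (2 * e^4))"
  proof -
    have "2 * e ^ 34 = e^2 + 7 * e^2" "(e ^ 34)^2 = 2 * e^4 + 7 * (2 * e^4)"
      unfolding e34 by Groebner_Basis.algebra+
    hence "2 * e ^ 34 = e^2" "(e ^ 34)^2 = 2 * e^4" by (simp_all only: zero)
    thus ?thesis using exceptional_mult_power_e[of 3 2 34] unfolding normal_form_eq_mult_power by simp
  qed
  moreover have "exceptional (normal_form e 0 (5 * e^2) 0 (6 * e^3))"
  proof -
    have "3 * e ^ 41 = e + 7 * (2 * e)" "3 * (e ^ 41)^2 = 5 * e^2 + 7 * (10 * e^2)"
      "(e ^ 41)^3 = 6 * e^3 + 7 * (17 * e^3)"
      unfolding e41 by Groebner_Basis.algebra+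
    hence "3 * e ^ 41 = e" "3 * (e ^ 41)^2 = 5 * e^2" "(e ^ 41)^3 = 6 * e^3" by (simp_all only: zero)
    thus ?thesis using exceptional_mult_power_e[of 2 3 41] unfolding normal_form_eq_mult_power by simp
  qed
  ultimately show ?thesis using assms unfolding exceptional_representatives_def by auto
qed

end

theorem proposition16:
  fixes e :: "'a :: finite_field"
  assumes "CARD('a) = 7 ^ 2"
    and "e ^ 2 + 6 * e + 3 = 0"
  shows "(\<forall>f :: 'a poly. degree f = 7 \<and> permutation_polynomial f \<and> \<not> exceptional f \<longrightarrow>
            linearly_related f
              (monom 1 7 + monom e 5 + monom (e ^ 18) 3 + monom (e ^ 35) 1)) \<and>
         (\<forall>f :: 'a poly. degree f = 7 \<and> exceptional f \<longrightarrow>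
            (\<exists>!g. g \<in> {monom 1 7 + monom a 1 | a. a \<in> {0, e, e ^ 2, e ^ 3, e ^ 4, e ^ 5}}
                    \<union> {monom 1 7 + monom 1 4 + monom 2 1,
                       monom 1 7 + monom (e ^ 2) 4 + monom (2 * e ^ 4) 1}
                    \<union> {monom 1 7 + monom e 5 + monom (5 * e ^ 2) 3 + monom (6 * e ^ 3) 1}
                  \<and> linearly_related f g))"
proof -
  interpret field49 e by standard (use assms in simp_all)
  have nf: "monom 1 7 + monom a 5 + monom b 3 + monom d 1 = normal_form a 0 b 0 d"
    "monom 1 7 + monom a 4 + monom d 1 = normal_form 0 a 0 0 d"
    "monom 1 7 + monom d 1 = normal_form 0 0 0 0 d" for a b d :: 'a
    by (simp_all add: normal_form_def monom_altdef eval_nat_numeral)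
  have "e ^ 18 = e ^ 16 * e ^ 2" "e ^ 35 = (e ^ 16)^2 * e ^ 3" by (simp_all flip: power_add power_mult)
  hence e18: "e ^ 18 = 2 * e ^ 2" "e ^ 35 = 4 * e ^ 3" by (simp_all add: e_power16)
  \<comment> \<open>A relation to a representative would transport its exceptionality back to
    \<open>f\<close>.\<close>
  have "linearly_related f special"
    if f: "degree f = 7" "permutation_polynomial f" "\<not> exceptional f" for f :: "'a poly"
    using classification[OF f(1) permutation_polynomial_imp_ext_1[OF f(2)]] f(3)
      exceptional_linearly_related linearly_related_sym exceptional_exceptional_representatives by blast
  moreover have "\<exists>!g. g \<in> exceptional_representatives \<and> linearly_related f g"
    if f: "degree f = 7" "exceptional f" for f :: "'a poly"
  proof -
    have "permutation_polynomial_ext 1 f"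
      using f(2) by (intro permutation_polynomial_imp_ext_1 exceptional_imp_permutation_polynomial)
    \<comment> \<open>A relation to \<open>special\<close> would make \<open>special\<close>
      exceptional.\<close>
    hence "\<exists>g\<in>exceptional_representatives. linearly_related f g"
      using classification[OF f(1)] f(2) not_exceptional_special exceptional_linearly_related by blast
    thus ?thesis
      using exceptional_representatives_unique linearly_related_sym linearly_related_trans by metis
  qed
  ultimately show ?thesis
    unfolding nf e18 special_def[symmetric] exceptional_representatives_def[symmetric] by blast
qed

end
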